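(* Let $d>2$ be an integer, let $f,g\in\mathbb{C}[x_0,x_1,x_2]$ be homogeneous polynomials of degree $d$ without a common factor, and let $P=\{\lambda f(x_0,x_1,x_2)+\mu g(x_0,x_1,x_2)=0 \mid [\lambda:\mu]\in\mathbb{CP}^1\}$ be the pencil they generate. Assume that $P$ has transverse intersections at its base points. Let $m$ be the number of conic-line curves in $P$, and let $p$ be the number of those conic-line curves that are pencils of $d$ lines, i.e. unions of $d$ concurrent lines. Then: (i) $m\leq 6$; (ii) if $p=1$, then $m\leq 5$; (iii) if $p=2$, then $m\leq 4$; (iv) if $p=3$, then $m=3$.
   Context: Curves are in the complex projective plane $\mathbb{CP}^2$. A conic-line curve is a curve each of whose irreducible components is a line or an irreducible conic, i.e. it is defined by a form $\prod_{i=1}^t\alpha_i^{m_i}$ with $\alpha_i$ distinct (pairwise non-proportional) linear or irreducible quadratic forms and $m_i\in\mathbb{Z}_{>0}$. Any two distinct curves of the pencil $P$ meet in the same set of points $\mathcal{X}=\{f=g=0\}\subset\mathbb{CP}^2$, the base locus; its points are the base points. "Transverse intersections at the base points" means that the curves $f=0$ and $g=0$ intersect transversely, so that $|\mathcal{X}|=d^2$. A pencil of $d$ lines (as a curve) is the union of $d$ distinct lines all passing through a single common point. The conic-line curves in $P$ are the members $\lambda f+\mu g=0$, $[\lambda:\mu]\in\mathbb{CP}^1$, that are conic-line curves. *)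

theory Defs
  imports "HOL-Analysis.Analysis" "HOL-Computational_Algebra.Polynomial_Factorial"
begin

(* C[x0,x1,x2] is represented as C[x2][x1][x0]: the outermost variable is x0 and
   coeff (coeff (coeff F i) j) k is the coefficient of x0^i * x1^j * x2^k. *)
type_synonym poly3 = "complex poly poly poly"

(* Coordinates of type complex^3 are indexed 1, 2, 3 and stand for x0, x1, x2. *)
definition eval3 :: "poly3 \<Rightarrow> complex^3 \<Rightarrow> complex" where
  "eval3 F v = poly (poly (poly F [:[:v$1:]:]) [:v$2:]) (v$3)"

(* The zero polynomial is a form of every degree. *)
definition is_form :: "nat \<Rightarrow> poly3 \<Rightarrow> bool" where
  "is_form d F \<longleftrightarrow> (\<forall>i j k. coeff (coeff (coeff F i) j) k \<noteq> 0 \<longrightarrow> i + j + k = d)"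

definition scale :: "complex \<Rightarrow> poly3 \<Rightarrow> poly3" where
  "scale c F = smult [:[:c:]:] F"

definition gradient :: "poly3 \<Rightarrow> complex^3 \<Rightarrow> complex^3" where
  "gradient F v = vector
     [eval3 (pderiv F) v,
      eval3 (map_poly pderiv F) v,
      eval3 (map_poly (map_poly pderiv) F) v]"

(* A curve, with the multiplicities of its components, is a form up to nonzero
   scalars; so products of forms define unions of curves, and two forms define
   the same curve iff they are proportional. *)
definition curve :: "poly3 \<Rightarrow> poly3 set" where
  "curve F = {scale c F |c. c \<noteq> 0}"

(* Points of CP^2 are given by nonzero coordinate vectors; the condition in
   transverse_at_base_points does not depend on the chosen representative. *)
definition is_base_point :: "poly3 \<Rightarrow> poly3 \<Rightarrow> complex^3 \<Rightarrow> bool" where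
  "is_base_point f g v \<longleftrightarrow> v \<noteq> 0 \<and> eval3 f v = 0 \<and> eval3 g v = 0"

(* Linear independence of the gradients: both curves are smooth at the point
   and their tangent lines there are different. *)
definition transverse_at_base_points :: "poly3 \<Rightarrow> poly3 \<Rightarrow> bool" where
  "transverse_at_base_points f g \<longleftrightarrow>
     (\<forall>v. is_base_point f g v \<longrightarrow>
        (\<forall>a b. a *s gradient f v + b *s gradient g v = 0 \<longrightarrow> a = 0 \<and> b = 0))"

definition pencil :: "poly3 \<Rightarrow> poly3 \<Rightarrow> poly3 set set" where
  "pencil f g = {curve (scale a f + scale b g) |a b. (a, b) \<noteq> (0, 0)}"

definition is_linear_form :: "poly3 \<Rightarrow> bool" where
  "is_linear_form F \<longleftrightarrow> is_form 1 F \<and> F \<noteq> 0"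

definition is_irreducible_quadratic_form :: "poly3 \<Rightarrow> bool" where
  "is_irreducible_quadratic_form F \<longleftrightarrow> is_form 2 F \<and> irreducible F"

definition conic_line_curve :: "poly3 set \<Rightarrow> bool" where
  "conic_line_curve C \<longleftrightarrow>
     (\<exists>(t::nat) (\<alpha> :: nat \<Rightarrow> poly3) (m :: nat \<Rightarrow> nat).
        t \<ge> 1 \<and>
        (\<forall>i\<in>{1..t}. (is_linear_form (\<alpha> i) \<or> is_irreducible_quadratic_form (\<alpha> i)) \<and> m i > 0) \<and>
        (\<forall>i\<in>{1..t}. \<forall>j\<in>{1..t}. i \<noteq> j \<longrightarrow> curve (\<alpha> i) \<noteq> curve (\<alpha> j)) \<and>
        C = curve (\<Prod>i=1..t. \<alpha> i ^ m i))"

definition pencil_of_lines :: "nat \<Rightarrow> poly3 set \<Rightarrow> bool" where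
  "pencil_of_lines d C \<longleftrightarrow>
     (\<exists>l :: nat \<Rightarrow> poly3.
        (\<forall>i\<in>{1..d}. is_linear_form (l i)) \<and>
        (\<forall>i\<in>{1..d}. \<forall>j\<in>{1..d}. i \<noteq> j \<longrightarrow> curve (l i) \<noteq> curve (l j)) \<and>
        (\<exists>v. v \<noteq> 0 \<and> (\<forall>i\<in>{1..d}. eval3 (l i) v = 0)) \<and>
        C = curve (\<Prod>i=1..d. l i))"

end

theory Submission
  imports Defs
    "HOL-Computational_Algebra.Field_as_Ring"
    "HOL-Computational_Algebra.Fundamental_Theorem_Algebra"
begin

text \<open>
  The bound is a count of singular points with multiplicity. Put \<open>e = d - 1\<close>. The singular points of all
  members of the pencil are the points where the \<open>2 \<times> 2\<close> minors of the matrix with rows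
  \<open>\<nabla>f\<close> and \<open>\<nabla>g\<close> vanish, and these minors define a scheme of degree \<open>3 * e\<^sup>2\<close>. Each member
  uses up a part of this number: a curve whose components have degrees \<open>a\<^sub>1, \<dots>, a\<^sub>t\<close> at least
  the sum of the intersection numbers \<open>a\<^sub>i * a\<^sub>j\<close> of its components, which is at least
  \<open>d * (d - 2) / 2\<close> if all components are lines and conics, and \<open>d\<close> concurrent lines use up
  \<open>e\<^sup>2\<close>. Different members use up different points, since a common singular point would be a base
  point where the pencil is not transverse. Comparing the sum with \<open>3 * e\<^sup>2\<close> gives all four claims
  (\<open>weights_le\<close>).

  All multiplicities are handled as codimensions of graded ideals in large degrees, so that no
  local algebra is needed.

  \<^item> Upper bound (\<open>codim_minors_le\<close>). If the minors have no common factor, their syzygies are the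
    combinations of \<open>\<nabla>f\<close> and \<open>\<nabla>g\<close> (\<open>syzygy_of_minors\<close>), and rank-nullity
    gives codimension at most \<open>3 * e\<^sup>2\<close>. A common factor \<open>h\<close> is excluded in
    \<open>transverse_no_common_prime\<close>: the function \<open>f / g\<close> would be constant on the curve \<open>h = 0\<close>, so that
    \<open>h\<close> would divide a member of the pencil, and this member would meet another one on \<open>h = 0\<close> in a
    point that violates transversality.

  \<^item> Lower bounds (\<open>product_of_lines_and_conics_bound\<close>, \<open>cone_bound\<close>). For a product \<open>F\<close> of
    \<open>x\<^sub>1, \<dots>, x\<^sub>t\<close> the derivatives of \<open>F\<close> lie in the ideal generated by all
    \<open>F / x\<^sub>i\<close>. Its codimension is estimated by adding one factor at a time. For concurrent lines the
    derivatives lie in an ideal generated by two forms of degree \<open>e\<close>.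

  \<^item> Independence (\<open>codim_ge_Int\<close>). Codimensions of graded ideals without common zero add up, by
    the projective Nullstellensatz, which is proved here by linear algebra.
\<close>

section \<open>Dimensions in infinite-dimensional vector spaces\<close>

text \<open>The polynomials form a vector space of infinite dimension, but only subspaces of spaces of
  forms are measured.\<close>

definition (in vector_space) finite_span :: "'b set \<Rightarrow> bool" where
  "finite_span V \<longleftrightarrow> (\<exists>W. finite W \<and> V \<subseteq> span W)"

context vector_space begin

lemma finite_span_subset: "finite_span V \<Longrightarrow> U \<subseteq> V \<Longrightarrow> finite_span U"
  unfolding finite_span_def by blast

lemma finite_basis_exists:
  assumes "finite_span V" "C \<subseteq> V" "independent C"
  obtains B where "C \<subseteq> B" "B \<subseteq> V" "independent B" "V \<subseteq> span B" "finite B" "card B = dim V"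
proof -
  obtain B where B: "C \<subseteq> B" "B \<subseteq> V" "independent B" "V \<subseteq> span B"
    using maximal_independent_subset_extend assms(2,3) by metis
  obtain W where W: "finite W" "V \<subseteq> span W" using assms(1) unfolding finite_span_def by blast
  have "finite B" using independent_span_bound[OF W(1) B(3)] B(2) W(2) by blast
  then show thesis using that[of B] B basis_card_eq_dim[OF B(2,4,3)] by auto
qed

lemma dim_mono_finite_span:
  assumes "finite_span V" "U \<subseteq> V"
  shows "dim U \<le> dim V"
proof -
  obtain B where B: "B \<subseteq> V" "V \<subseteq> span B" "finite B" "card B = dim V"
    by (rule finite_basis_exists[OF assms(1) empty_subsetI independent_empty])
  show ?thesis using dim_le_card[of U B] B assms(2) by auto
qed

lemma subspace_eq_of_dim_le:
  assumes "finite_span V" "U \<subseteq> V" "subspace U" "dim V \<le> dim U"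
  shows "U = V"
proof -
  obtain C where C: "C \<subseteq> U" "independent C" "U \<subseteq> span C" "finite C" "card C = dim U"
    by (rule finite_basis_exists[OF finite_span_subset[OF assms(1,2)] empty_subsetI independent_empty])
  obtain B where B: "C \<subseteq> B" "B \<subseteq> V" "V \<subseteq> span B" "finite B" "card B = dim V"
    by (rule finite_basis_exists[OF assms(1) order_trans[OF C(1) assms(2)] C(2)])
  have "C = B" using card_subset_eq[of B C] card_mono[of B C] B C assms(4) by simp
  then have "V \<subseteq> U" using B(3) C(1) span_minimal[OF _ assms(3)] by blast
  then show ?thesis using assms(2) by blast
qed

end

context vector_space_pair begin

text \<open>A basis of the kernel is extended to a basis of \<open>A\<close>. The added vectors are mapped to a basis of
  the image.\<close>

theorem rank_nullity:
  assumes lin: "Vector_Spaces.linear s1 s2 T"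
    and A: "vs1.subspace A" "vs1.finite_span A"
  shows "vs2.dim (T ` A) + vs1.dim {a \<in> A. T a = 0} = vs1.dim A"
proof -
  interpret T: Vector_Spaces.linear s1 s2 T by fact
  let ?N = "{a \<in> A. T a = 0}"
  have N: "?N \<subseteq> A" by auto
  have subN: "vs1.subspace ?N" using A(1) unfolding vs1.subspace_def
    by (auto simp: T.add T.scale)
  obtain C where C: "C \<subseteq> ?N" "vs1.independent C" "?N \<subseteq> vs1.span C" "finite C" "card C = vs1.dim ?N"
    by (rule vs1.finite_basis_exists[OF vs1.finite_span_subset[OF A(2) N] empty_subsetI vs1.independent_empty])
  obtain B where B: "C \<subseteq> B" "B \<subseteq> A" "vs1.independent B" "A \<subseteq> vs1.span B" "finite B" "card B = vs1.dim A"
    by (rule vs1.finite_basis_exists[OF A(2) order_trans[OF C(1) N] C(2)])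
  let ?D = "B - C"
  have key: "x \<in> ?D \<longrightarrow> u x = 0" if "(\<Sum>v\<in>?D. s2 (u v) (T v)) = 0" for u x
  proof -
    let ?w = "\<Sum>v\<in>?D. s1 (u v) v"
    have "T ?w = 0" using that by (simp add: T.sum T.scale)
    moreover have "?w \<in> A" using B(2) by (auto intro!: vs1.subspace_sum[OF A(1)] vs1.subspace_scale[OF A(1)])
    ultimately have "?w \<in> vs1.span C" using C(3) by auto
    then obtain r where r: "?w = (\<Sum>v\<in>C. s1 (r v) v)"
      using C(4) by (auto simp: vs1.span_finite)
    let ?c = "\<lambda>v. if v \<in> C then - r v else u v"
    have "(\<Sum>v\<in>B. s1 (?c v) v) = (\<Sum>v\<in>?D. s1 (?c v) v) + (\<Sum>v\<in>C. s1 (?c v) v)"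
      using sum.subset_diff[OF B(1,5)] by blast
    also have "\<dots> = ?w - (\<Sum>v\<in>C. s1 (r v) v)"
      by (simp add: sum_negf)
    finally have "(\<Sum>v\<in>B. s1 (?c v) v) = 0" using r by simp
    from vs1.independentD[OF B(3,5) order_refl this, of x] show ?thesis by (auto split: if_splits)
  qed
  have inj: "inj_on T ?D"
  proof (rule inj_onI, rule ccontr)
    fix x y assume xy: "x \<in> ?D" "y \<in> ?D" "T x = T y" "x \<noteq> y"
    let ?u = "\<lambda>v. if v = x then 1 else if v = y then - 1 else 0"
    have "(\<Sum>v\<in>?D. s2 (?u v) (T v)) = (\<Sum>v\<in>{x,y}. s2 (?u v) (T v))"
      using xy B(5) by (intro sum.mono_neutral_right) auto
    also have "\<dots> = 0" using xy by simp
    finally show False using key[of ?u x] xy(1) by simp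
  qed
  have ind: "vs2.independent (T ` ?D)"
  proof (rule vs2.independent_if_scalars_zero)
    show "finite (T ` ?D)" using B(5) by simp
    fix f x assume "(\<Sum>x\<in>T ` ?D. s2 (f x) x) = 0" "x \<in> T ` ?D"
    then show "f x = 0" using key[of "\<lambda>v. f (T v)"] by (auto simp: sum.reindex[OF inj])
  qed
  have "T ` A \<subseteq> vs2.span (T ` ?D)"
  proof
    fix y assume "y \<in> T ` A"
    then obtain a where a: "a \<in> A" "y = T a" by blast
    then obtain r where r: "a = (\<Sum>v\<in>B. s1 (r v) v)"
      using B(4,5) by (auto simp: vs1.span_finite)
    have "T a = (\<Sum>v\<in>B. s2 (r v) (T v))" by (simp add: r T.sum T.scale)
    also have "\<dots> = (\<Sum>v\<in>?D. s2 (r v) (T v))"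
      using C(1) B(5) by (intro sum.mono_neutral_right) auto
    also have "\<dots> \<in> vs2.span (T ` ?D)"
      by (intro vs2.span_sum vs2.span_scale vs2.span_base) auto
    finally show "y \<in> vs2.span (T ` ?D)" using a by simp
  qed
  then have "vs2.dim (T ` A) = card (T ` ?D)"
    using vs2.dim_unique[of "T ` ?D" "T ` A"] ind B(2) by blast
  also have "\<dots> = card B - card C"
    using card_image[OF inj] card_Diff_subset[OF C(4) B(1)] by simp
  finally show ?thesis using C(5) B(5,6) card_mono[OF B(5) B(1)] by simp
qed

corollary dim_image_inj:
  assumes "Vector_Spaces.linear s1 s2 T" "vs1.subspace A" "vs1.finite_span A"
    and "\<And>a. a \<in> A \<Longrightarrow> T a = 0 \<Longrightarrow> a = 0"
  shows "vs2.dim (T ` A) = vs1.dim A"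
proof -
  interpret T: Vector_Spaces.linear s1 s2 T by fact
  have "{a \<in> A. T a = 0} = {0}" using assms(2,4) vs1.subspace_0 T.zero by auto
  moreover have "vs1.dim {0} = 0"
    using vs1.dim_le_card[of "{0}" "{}"] vs1.span_zero by simp
  ultimately show ?thesis using rank_nullity[OF assms(1-3)] by simp
qed

end

context vector_space_prod begin

lemma finite_span_Times:
  assumes "vs1.finite_span A" "vs2.finite_span B"
  shows "p.finite_span (A \<times> B)"
proof -
  obtain V W where VW: "finite V" "A \<subseteq> vs1.span V" "finite W" "B \<subseteq> vs2.span W"
    using assms unfolding vs1.finite_span_def vs2.finite_span_def by blast
  let ?U = "V \<times> {0} \<union> {0} \<times> W"
  have "(a, b) \<in> p.span ?U" if "a \<in> A" "b \<in> B" for a b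
  proof -
    have "(a, 0) \<in> p.span (V \<times> {0})" "(0, b) \<in> p.span ({0} \<times> W)"
      using that VW by (auto simp: span_Times_sing1 span_Times_sing2)
    then have "(a, 0) + (0, b) \<in> p.span ?U"
      using p.span_mono[of "V \<times> {0}" ?U] p.span_mono[of "{0} \<times> W" ?U]
      by (intro p.span_add) blast+
    then show ?thesis by simp
  qed
  then show ?thesis unfolding p.finite_span_def using VW by (intro exI[of _ ?U]) auto
qed

lemma dim_Times:
  assumes "vs1.subspace A" "vs1.finite_span A" "vs2.subspace B" "vs2.finite_span B"
  shows "p.dim (A \<times> B) = vs1.dim A + vs2.dim B"
proof -
  interpret q: vector_space_pair scale s1 by unfold_locales
  interpret r: vector_space_pair s2 scale by unfold_locales
  have l: "Vector_Spaces.linear s2 scale (Pair 0)"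
    by unfold_locales (auto simp: scale_def)
  have "fst ` (A \<times> B) = A" using vs2.subspace_0[OF assms(3)] by force
  moreover have "{x \<in> A \<times> B. fst x = 0} = Pair 0 ` B" using vs1.subspace_0[OF assms(1)] by auto
  moreover have "p.dim (Pair 0 ` B) = vs2.dim B"
    by (rule r.dim_image_inj[OF l assms(3,4)]) (auto simp: zero_prod_def)
  ultimately show ?thesis
    using q.rank_nullity[OF linear_fst subspace_Times[OF assms(1,3)] finite_span_Times[OF assms(2,4)]]
    by simp
qed

end

text \<open>Rank-nullity for the addition map on \<open>A \<times> B\<close>, whose kernel is a copy of the intersection.\<close>

lemma (in vector_space) dim_sum_Int:
  assumes "subspace A" "finite_span A" "subspace B" "finite_span B"
  shows "dim {x + y |x y. x \<in> A \<and> y \<in> B} + dim (A \<inter> B) = dim A + dim B"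
proof -
  interpret pr: vector_space_prod scale scale by unfold_locales
  interpret q: vector_space_pair pr.scale scale by unfold_locales
  interpret r: vector_space_pair scale pr.scale by unfold_locales
  have l: "Vector_Spaces.linear pr.scale scale (\<lambda>z. fst z + snd z)"
    by unfold_locales (auto simp: pr.scale_def algebra_simps)
  have l': "Vector_Spaces.linear scale pr.scale (\<lambda>x. (x, - x))"
    by unfold_locales (auto simp: pr.scale_def algebra_simps)
  have im: "(\<lambda>z. fst z + snd z) ` (A \<times> B) = {x + y |x y. x \<in> A \<and> y \<in> B}" by force
  have ker: "{z \<in> A \<times> B. fst z + snd z = 0} = (\<lambda>x. (x, - x)) ` (A \<inter> B)"
    using assms(3) subspace_neg[OF assms(3)] by (force simp: add_eq_0_iff image_iff)
  have "pr.p.dim ((\<lambda>x. (x, - x)) ` (A \<inter> B)) = dim (A \<inter> B)"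
    by (rule r.dim_image_inj[OF l' subspace_inter[OF assms(1,3)] finite_span_subset[OF assms(2)]])
      (auto simp: zero_prod_def)
  then show ?thesis
    using q.rank_nullity[OF l pr.subspace_Times[OF assms(1,3)] pr.finite_span_Times[OF assms(2,4)]]
    by (simp add: im ker pr.dim_Times[OF assms])
qed

text \<open>Bounds a dimension from below, and by contraposition provides a linear relation modulo \<open>H\<close>
  among sufficiently many vectors.\<close>

lemma (in vector_space) card_add_dim_le:
  assumes V: "subspace V" "finite_span V" and H: "subspace H" "H \<subseteq> V"
    and I: "finite I" "\<And>i. i \<in> I \<Longrightarrow> w i \<in> V"
    and ind: "\<And>c i. (\<Sum>i\<in>I. scale (c i) (w i)) \<in> H \<Longrightarrow> i \<in> I \<Longrightarrow> c i = 0"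
  shows "card I + dim H \<le> dim V"
proof -
  have inj: "inj_on w I"
  proof (rule inj_onI, rule ccontr)
    fix x y assume xy: "x \<in> I" "y \<in> I" "w x = w y" "x \<noteq> y"
    let ?u = "\<lambda>v. if v = x then 1 else if v = y then - 1 else 0"
    have "(\<Sum>v\<in>I. scale (?u v) (w v)) = (\<Sum>v\<in>{x,y}. scale (?u v) (w v))"
      using xy I(1) by (intro sum.mono_neutral_right) auto
    also have "\<dots> = 0" using xy by simp
    finally show False using ind[of ?u x] xy(1) subspace_0[OF H(1)] by simp
  qed
  let ?W = "span (w ` I)"
  have W: "subspace ?W" "finite_span ?W" using I(1) by (auto simp: finite_span_def)
  have indW: "independent (w ` I)"
  proof (rule independent_if_scalars_zero)
    show "finite (w ` I)" using I(1) by simp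
    fix f x assume "(\<Sum>x\<in>w ` I. scale (f x) x) = 0" "x \<in> w ` I"
    then show "f x = 0" using ind[of "\<lambda>v. f (w v)"] subspace_0[OF H(1)] by (auto simp: sum.reindex[OF inj])
  qed
  then have dW: "dim ?W = card I" using dim_span_eq_card_independent card_image[OF inj] by metis
  have WV: "?W \<subseteq> V" using I(2) by (intro span_minimal V) auto
  have "?W \<inter> H \<subseteq> {0}"
  proof
    fix x assume x: "x \<in> ?W \<inter> H"
    then obtain r where r: "x = (\<Sum>v\<in>w ` I. scale (r v) v)"
      using I(1) by (auto simp: span_finite)
    then have "x = (\<Sum>i\<in>I. scale (r (w i)) (w i))" by (simp add: sum.reindex[OF inj])
    moreover from this have "\<forall>i\<in>I. r (w i) = 0" using x ind[of "\<lambda>i. r (w i)"] by auto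
    ultimately show "x \<in> {0}" by simp
  qed
  then have "dim (?W \<inter> H) = 0" using dim_le_card[of "?W \<inter> H" "{}"] by simp
  then have "card I + dim H = dim {x + y |x y. x \<in> ?W \<and> y \<in> H}"
    using dim_sum_Int[OF W H(1) finite_span_subset[OF V(2) H(2)]] dW by simp
  also have "\<dots> \<le> dim V"
    using WV H(2) by (intro dim_mono_finite_span V) (auto intro: subspace_add[OF V(1)])
  finally show ?thesis .
qed

section \<open>Forms as eigenvectors of the Euler operator\<close>

text \<open>Numbered like the components of \<open>gradient\<close>.\<close>

definition pd :: "3 \<Rightarrow> poly3 \<Rightarrow> poly3" where
  "pd i F = (if i = 1 then pderiv F else if i = 2 then map_poly pderiv F
             else map_poly (map_poly pderiv) F)"

definition var :: "3 \<Rightarrow> poly3" where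
  "var i = (if i = 1 then [:0, 1:] else if i = 2 then [:[:0, 1:]:] else [:[:[:0, 1:]:]:])"

definition const3 :: "complex \<Rightarrow> poly3" where
  "const3 c = [:[:[:c:]:]:]"

lemma scale_conv: "scale c F = const3 c * F"
  by (simp add: scale_def const3_def)

lemma const3_simps [simp]:
  "const3 0 = 0" "const3 1 = 1"
  "const3 (a + b) = const3 a + const3 b" "const3 (a * b) = const3 a * const3 b"
  "const3 (- a) = - const3 a" "const3 (a - b) = const3 a - const3 b"
  by (simp_all add: const3_def one_pCons)

lemma const3_eq_0_iff [simp]: "const3 a = 0 \<longleftrightarrow> a = 0"
  by (simp add: const3_def)

lemma const3_of_nat [simp]: "const3 (of_nat n) = of_nat n"
  by (induction n) simp_all

lemma const3_of_int [simp]: "const3 (of_int n) = of_int n"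
  by (cases n) simp_all

interpretation S3: vector_space scale
  by unfold_locales (simp_all add: scale_conv algebra_simps)

lemma map_poly_add_of_additive:
  assumes "D 0 = 0" "\<And>a b. D (a + b) = D a + D b"
  shows "map_poly D (p + q) = map_poly D p + map_poly D q"
  by (rule poly_eqI) (simp add: coeff_map_poly assms)

lemma additive_sum:
  assumes "D 0 = 0" "\<And>a b. D (a + b) = D a + D b"
  shows "D (sum f A) = (\<Sum>x\<in>A. D (f x))"
  by (induction A rule: infinite_finite_induct) (simp_all add: assms)

lemma map_poly_mult_of_derivation:
  fixes D :: "'a::comm_ring_1 \<Rightarrow> 'a"
  assumes D: "D 0 = 0" "\<And>a b. D (a + b) = D a + D b" "\<And>a b. D (a * b) = D a * b + a * D b"
  shows "map_poly D (p * q) = map_poly D p * q + p * map_poly D q"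
  by (rule poly_eqI)
    (simp add: coeff_map_poly D coeff_mult additive_sum[of D, OF D(1,2)] sum.distrib)

lemma pderiv_map_poly_commute:
  fixes D :: "'a::{comm_ring_1, ring_char_0, idom} \<Rightarrow> 'a"
  assumes D: "D 0 = 0" "\<And>a b. D (a + b) = D a + D b"
  shows "pderiv (map_poly D p) = map_poly D (pderiv p)"
proof -
  have "D (of_nat n * a) = of_nat n * D a" for n a
    by (induction n) (simp_all add: D algebra_simps)
  then have "D ((1 + of_nat n) * a) = (1 + of_nat n) * D a" for n a
    by (metis of_nat_Suc)
  then show ?thesis by (intro poly_eqI) (simp add: coeff_map_poly D coeff_pderiv)
qed

lemma mpd_add [simp]: "map_poly pderiv (p + q) = map_poly pderiv p + map_poly pderiv q"
  for p q :: "complex poly poly"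
  by (rule map_poly_add_of_additive) (auto simp: pderiv_add)

lemma mpd_mult: "map_poly pderiv (p * q) = map_poly pderiv p * q + p * map_poly pderiv q"
  for p q :: "complex poly poly"
  by (rule map_poly_mult_of_derivation) (auto simp: pderiv_add pderiv_mult)

lemma pd_add [simp]: "pd i (F + G) = pd i F + pd i G"
  unfolding pd_def
  by (auto simp: pderiv_add map_poly_add_of_additive)

lemma pd_mult: "pd i (F * G) = pd i F * G + F * pd i G"
proof -
  have 2: "map_poly pderiv (F * G) = map_poly pderiv F * G + F * map_poly pderiv G"
    by (rule map_poly_mult_of_derivation) (auto simp: pderiv_add pderiv_mult)
  have 3: "map_poly (map_poly pderiv) (F * G)
      = map_poly (map_poly pderiv) F * G + F * map_poly (map_poly pderiv) G"
    by (rule map_poly_mult_of_derivation) (auto simp: mpd_mult)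
  show ?thesis unfolding pd_def using 2 3 by (auto simp: pderiv_mult algebra_simps)
qed

lemma pd_commute: "pd i (pd j F) = pd j (pd i F)"
proof -
  have 12: "pderiv (map_poly pderiv F) = map_poly pderiv (pderiv F)"
    by (rule pderiv_map_poly_commute) (auto simp: pderiv_add)
  have 13: "pderiv (map_poly (map_poly pderiv) F) = map_poly (map_poly pderiv) (pderiv F)"
    by (rule pderiv_map_poly_commute) auto
  have 23: "map_poly pderiv (map_poly (map_poly pderiv) F) = map_poly (map_poly pderiv) (map_poly pderiv F)"
    by (rule poly_eqI) (simp add: coeff_map_poly pderiv_map_poly_commute pderiv_add)
  show ?thesis unfolding pd_def using 12 13 23 by auto
qed

lemma pd_const3 [simp]: "pd i (const3 c) = 0"
  by (simp add: pd_def const3_def map_poly_pCons)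

lemma pd_0 [simp]: "pd i 0 = 0" and pd_1 [simp]: "pd i 1 = 0"
  using pd_const3[of i 0] pd_const3[of i 1] by (simp_all del: pd_const3)

lemma pd_uminus [simp]: "pd i (- F) = - pd i F"
  using pd_add[of i F "- F"] by (simp add: eq_neg_iff_add_eq_0 add.commute del: pd_add)

lemma pd_diff [simp]: "pd i (F - G) = pd i F - pd i G"
  using pd_add[of i F "- G"] by simp

lemma pd_sum: "pd i (sum f A) = (\<Sum>x\<in>A. pd i (f x))"
  by (induction A rule: infinite_finite_induct) simp_all

lemma pd_scale [simp]: "pd i (scale c F) = scale c (pd i F)"
  by (simp add: scale_conv pd_mult)

lemma pd_power: "pd i (F ^ n) = of_nat n * F ^ (n - 1) * pd i F"
proof (induction n)
  case (Suc n)
  then show ?case by (cases n) (simp_all add: pd_mult algebra_simps)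
qed simp

lemma pd_var: "pd i (var j) = (if i = j then 1 else 0)"
  using exhaust_3[of i] exhaust_3[of j]
  by (auto simp: pd_def var_def map_poly_pCons pderiv_pCons one_pCons)

definition euler :: "poly3 \<Rightarrow> poly3" where
  "euler F = (\<Sum>i\<in>UNIV. var i * pd i F)"

text \<open>Euler's formula, taken as the definition of a form. It makes products, derivatives and quotients
  of forms a matter of the Leibniz rule, without coefficients. Degrees are integers: forms of
  negative degree vanish, and dimension formulas need no truncated subtraction.\<close>

definition forms :: "int \<Rightarrow> poly3 set" where
  "forms n = {F. euler F = of_int n * F}"

lemma euler_add [simp]: "euler (F + G) = euler F + euler G"
  by (simp add: euler_def algebra_simps sum.distrib)

lemma euler_mult: "euler (F * G) = euler F * G + F * euler G"
  by (simp add: euler_def pd_mult algebra_simps sum.distrib sum_distrib_left)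

lemma euler_scale [simp]: "euler (scale c F) = scale c (euler F)"
  by (simp add: euler_def scale_conv pd_mult algebra_simps sum_distrib_left)

lemma euler_0 [simp]: "euler 0 = 0"
  by (simp add: euler_def)

lemma forms_0_mem [simp]: "0 \<in> forms n"
  by (simp add: forms_def)

lemma forms_subspace: "S3.subspace (forms n)"
  unfolding S3.subspace_def
proof (intro conjI ballI allI)
  show "scale c F \<in> forms n" if "F \<in> forms n" for c F
    using that unfolding forms_def by (simp only: euler_scale mem_Collect_eq) (simp add: scale_conv)
qed (auto simp: forms_def algebra_simps)

lemma forms_add: "F \<in> forms n \<Longrightarrow> G \<in> forms n \<Longrightarrow> F + G \<in> forms n"
  and forms_scale: "F \<in> forms n \<Longrightarrow> scale c F \<in> forms n"
  and forms_diff: "F \<in> forms n \<Longrightarrow> G \<in> forms n \<Longrightarrow> F - G \<in> forms n"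
  and forms_sum: "(\<And>i. i \<in> A \<Longrightarrow> f i \<in> forms n) \<Longrightarrow> sum f A \<in> forms n"
  using forms_subspace[of n]
  by (auto intro: S3.subspace_add S3.subspace_scale S3.subspace_diff S3.subspace_sum)

lemma forms_mult: "F \<in> forms n \<Longrightarrow> G \<in> forms k \<Longrightarrow> F * G \<in> forms (n + k)"
  by (simp add: forms_def euler_mult algebra_simps)

lemma forms_1: "1 \<in> forms 0"
  by (simp add: forms_def euler_def)

lemma forms_power: "F \<in> forms n \<Longrightarrow> F ^ k \<in> forms (int k * n)"
  by (induction k) (auto simp: forms_1 algebra_simps dest: forms_mult)

lemma forms_var: "var i \<in> forms 1"
  by (simp add: forms_def euler_def pd_var if_distrib cong: if_cong)

lemma forms_pd:
  assumes "F \<in> forms n" shows "pd i F \<in> forms (n - 1)"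
proof -
  have "pd i (euler F) = euler (pd i F) + pd i F"
    by (simp add: euler_def pd_sum pd_mult pd_var sum.distrib pd_commute[of _ i] add.commute
        if_distrib[of "\<lambda>x. x * _"] cong: if_cong)
  moreover have "pd i (of_int n * F) = of_int n * pd i F"
    using pd_scale[of i "of_int n" F] by (simp add: scale_conv)
  ultimately show ?thesis using assms by (simp add: forms_def algebra_simps eq_diff_eq)
qed

lemma forms_divide:
  assumes "h \<noteq> 0" "h \<in> forms k" "h * q \<in> forms n"
  shows "q \<in> forms (n - k)"
proof -
  have "h * (euler q - of_int (n - k) * q) = 0"
    using assms(2,3) by (simp add: forms_def euler_mult algebra_simps)
  then show ?thesis using assms(1) by (simp add: forms_def)
qed

subsection \<open>Coefficients\<close>

definition coeff3 :: "poly3 \<Rightarrow> nat \<Rightarrow> nat \<Rightarrow> nat \<Rightarrow> complex" where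
  "coeff3 F i j k = coeff (coeff (coeff F i) j) k"

lemma poly3_eqI: "(\<And>i j k. coeff3 F i j k = coeff3 G i j k) \<Longrightarrow> F = G"
  unfolding coeff3_def by (intro poly_eqI)

lemma coeff3_euler: "coeff3 (euler F) i j k = of_nat (i + j + k) * coeff3 F i j k"
proof -
  have X: "[:0, 1:] * p = pCons 0 p" for p :: "'a::comm_ring_1 poly" by simp
  have C: "coeff (pCons 0 p) n = (if n = 0 then 0 else coeff p (n - 1))" for p :: "'a::comm_ring_1 poly" and n
    by (cases n) auto
  have "coeff3 (var 1 * pd 1 F) i j k = of_nat i * coeff3 F i j k"
    by (cases i) (simp_all add: coeff3_def var_def pd_def coeff_pderiv of_nat_poly del: of_nat_Suc)
  moreover have "coeff3 (var 2 * pd 2 F) i j k = of_nat j * coeff3 F i j k"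
    by (cases j) (simp_all add: coeff3_def var_def pd_def coeff_pderiv coeff_map_poly C of_nat_poly del: of_nat_Suc)
  moreover have "coeff3 (var 3 * pd 3 F) i j k = of_nat k * coeff3 F i j k"
    by (cases k) (simp_all add: coeff3_def var_def pd_def coeff_pderiv coeff_map_poly C of_nat_poly del: of_nat_Suc)
  ultimately show ?thesis
    by (simp add: euler_def sum_3 coeff3_def algebra_simps)
qed

lemma coeff3_scale [simp]: "coeff3 (scale c F) i j k = c * coeff3 F i j k"
  by (simp add: coeff3_def scale_def)

lemma coeff3_sum: "coeff3 (sum f A) i j k = (\<Sum>x\<in>A. coeff3 (f x) i j k)"
  by (simp add: coeff3_def coeff_sum)

lemma eigen_iff_coeff3:
  "euler F = const3 c * F \<longleftrightarrow> (\<forall>i j k. coeff3 F i j k \<noteq> 0 \<longrightarrow> c = of_nat (i + j + k))"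
proof -
  have "euler F = scale c F \<longleftrightarrow> (\<forall>i j k. coeff3 (euler F) i j k = coeff3 (scale c F) i j k)"
    by (metis poly3_eqI)
  then show ?thesis by (auto simp: coeff3_euler scale_conv[symmetric])
qed

lemma forms_iff_coeff3:
  "F \<in> forms n \<longleftrightarrow> (\<forall>i j k. coeff3 F i j k \<noteq> 0 \<longrightarrow> n = int (i + j + k))"
proof -
  have "(of_int n :: complex) = of_nat m \<longleftrightarrow> n = int m" for m
    by (metis of_int_eq_iff of_int_of_nat_eq)
  then show ?thesis using eigen_iff_coeff3[of F "of_int n"] by (simp add: forms_def del: of_nat_add)
qed

lemma is_form_iff_forms: "is_form d F \<longleftrightarrow> F \<in> forms (int d)"
  unfolding is_form_def forms_iff_coeff3 coeff3_def by (metis of_nat_eq_iff)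

lemma forms_neg: "n < 0 \<Longrightarrow> forms n = {0}"
  by (auto simp: forms_iff_coeff3 intro!: poly3_eqI) (force simp: coeff3_def)+

lemma forms_zeroD:
  assumes "F \<in> forms 0" obtains c where "F = const3 c"
proof
  have "coeff3 F i j k = coeff3 (const3 (coeff3 F 0 0 0)) i j k" for i j k
  proof (cases "i = 0 \<and> j = 0 \<and> k = 0")
    case True then show ?thesis by (simp add: coeff3_def const3_def)
  next
    case False
    then have "coeff3 F i j k = 0" using assms unfolding forms_iff_coeff3 by fastforce
    then show ?thesis using False by (auto simp: coeff3_def const3_def coeff_pCons split: nat.splits)
  qed
  then show "F = const3 (coeff3 F 0 0 0)" by (rule poly3_eqI)
qed

text \<open>The left-hand side has at most the degree of \<open>p\<close>, so \<open>q\<close> is constant, and the leading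
  coefficients satisfy an equation of the same kind with one variable less.\<close>

lemma eigen_lift:
  fixes D :: "'a::{idom,ring_char_0} \<Rightarrow> 'a"
  assumes D: "D 0 = 0" and p: "p \<noteq> 0"
    and eq: "pCons 0 (pderiv p) + map_poly D p = q * p"
  obtains c where "q = [:c:]" "D (lead_coeff p) = (c - of_nat (degree p)) * lead_coeff p"
proof -
  have "degree (map_poly D p) \<le> degree p"
    by (intro degree_le) (simp add: coeff_map_poly D coeff_eq_0)
  moreover have "degree (pCons 0 (pderiv p)) \<le> degree p"
    by (intro degree_le) (auto simp: coeff_pCons coeff_pderiv coeff_eq_0 split: nat.splits)
  ultimately have le: "degree (q * p) \<le> degree p"
    using eq degree_add_le by metis
  then have "degree q = 0" using p by (cases "q = 0") (auto simp: degree_mult_eq)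
  then obtain c where c: "q = [:c:]" by (metis degree_eq_zeroE)
  have "coeff (pCons 0 (pderiv p) + map_poly D p) (degree p) = c * lead_coeff p"
    unfolding eq c by simp
  moreover have "coeff (pCons 0 (pderiv p)) n = of_nat n * coeff p n" for n
    by (cases n) (simp_all add: coeff_pderiv)
  ultimately show thesis using that[of c] c by (simp add: coeff_map_poly D algebra_simps)
qed

text \<open>The Euler operator does not raise the degree in any variable, so the quotient is a constant.
  Comparing any nonzero coefficient identifies this constant as a natural number.\<close>

lemma euler_dvdD:
  assumes "h \<noteq> 0" "h dvd euler h"
  obtains n where "h \<in> forms n"
proof -
  define D1 :: "complex poly \<Rightarrow> complex poly" where "D1 = (\<lambda>p. pCons 0 (pderiv p) + map_poly (\<lambda>_. 0) p)"
  define D2 :: "complex poly poly \<Rightarrow> complex poly poly" where "D2 = (\<lambda>p. pCons 0 (pderiv p) + map_poly D1 p)"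
  have z: "map_poly (\<lambda>_. 0) p = (0::complex poly)" for p :: "complex poly"
    by (rule poly_eqI) (simp add: coeff_map_poly)
  have D0: "D1 0 = 0" "D2 0 = 0" by (simp_all add: D1_def D2_def)
  have cp: "coeff (pCons 0 (pderiv p)) n = of_nat n * coeff p n"
    for n and p :: "'a::{idom,ring_char_0} poly" by (cases n) (simp_all add: coeff_pderiv)
  have E: "euler F = pCons 0 (pderiv F) + map_poly D2 F" for F
  proof (rule poly3_eqI, unfold coeff3_euler)
    show "of_nat (i + j + k) * coeff3 F i j k = coeff3 (pCons 0 (pderiv F) + map_poly D2 F) i j k" for i j k
      by (simp add: coeff3_def coeff_map_poly D0 cp D2_def D1_def z of_nat_poly algebra_simps)
  qed
  obtain q where q: "pCons 0 (pderiv h) + map_poly D2 h = q * h"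
    using assms(2) E by (metis dvdE mult.commute)
  obtain c2 where c2: "q = [:c2:]" "D2 (lead_coeff h) = (c2 - of_nat (degree h)) * lead_coeff h"
    using eigen_lift[where D = D2, OF D0(2) assms(1) q] by metis
  define h2 where "h2 = lead_coeff h"
  have h2: "h2 \<noteq> 0" using assms(1) by (simp add: h2_def)
  obtain c1 where c1: "c2 - of_nat (degree h) = [:c1:]" "D1 (lead_coeff h2) = (c1 - of_nat (degree h2)) * lead_coeff h2"
    using eigen_lift[where D = D1, OF D0(1) h2, of "c2 - of_nat (degree h)"] c2(2) unfolding D2_def h2_def by metis
  define h1 where "h1 = lead_coeff h2"
  have h1: "h1 \<noteq> 0" using h2 by (simp add: h1_def)
  obtain c0 where c0: "c1 - of_nat (degree h2) = [:c0:]"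
    using eigen_lift[where D = "\<lambda>_. 0", OF refl h1, of "c1 - of_nat (degree h2)"] c1(2) unfolding D1_def h1_def by metis
  have "c1 = [:c0 + of_nat (degree h2):]" using c0 by (simp add: of_nat_poly algebra_simps eq_diff_eq)
  then have "q = const3 (c0 + of_nat (degree h2) + of_nat (degree h))"
    using c1(1) c2(1) by (simp add: const3_def of_nat_poly algebra_simps diff_eq_eq)
  then obtain c where c: "euler h = const3 c * h" using q E by metis
  obtain i j k where "coeff3 h i j k \<noteq> 0" using assms(1) poly3_eqI[of h 0] by (auto simp: coeff3_def)
  then have "c = of_int (int (i + j + k))" using c unfolding eigen_iff_coeff3 by auto
  with c have "h \<in> forms (int (i + j + k))" by (simp only: forms_def mem_Collect_eq const3_of_int)
  then show thesis by (rule that)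
qed

text \<open>Writing the form as \<open>h ^ k * r\<close> with \<open>r\<close> prime to \<open>h\<close>, the Euler operator shows that
  \<open>h\<close> divides \<open>euler h\<close>.\<close>

lemma prime_dvd_form:
  assumes "prime_elem h" "h dvd F" "F \<in> forms n" "F \<noteq> 0"
  obtains k where "h \<in> forms k"
proof -
  have h: "h \<noteq> 0" "\<not> is_unit h" using assms(1) by (auto simp: prime_elem_def)
  define k where "k = multiplicity h F"
  obtain r where r: "F = h ^ k * r" "\<not> h dvd r"
    using multiplicity_decompose'[of F h] assms(4) h unfolding k_def by metis
  have "k > 0" using r assms(2) by (cases k) auto
  have ep: "euler (h ^ m) = of_nat m * h ^ (m - 1) * euler h" for m
    by (simp add: euler_def pd_power sum_distrib_left algebra_simps)
  have hk: "h ^ k = h ^ (k - 1) * h" using \<open>k > 0\<close> by (metis power_minus_mult)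
  have "of_nat k * h ^ (k - 1) * euler h * r + h ^ k * euler r = of_int n * (h ^ k * r)"
    using assms(3) unfolding forms_def by (simp only: mem_Collect_eq r(1) euler_mult ep)
  then have "h ^ (k - 1) * (of_nat k * euler h * r + h * euler r) = h ^ (k - 1) * (h * (of_int n * r))"
    unfolding hk by (simp only: algebra_simps)
  then have "of_nat k * euler h * r + h * euler r = h * (of_int n * r)"
    using h(1) by (simp only: mult_cancel_left power_eq_0_iff) simp
  then have "of_nat k * euler h * r = h * (of_int n * r - euler r)" by (simp only: algebra_simps)
  then have "h dvd of_nat k * euler h * r" by (metis dvd_triv_left)
  then have "h dvd of_nat k * euler h" using r(2) assms(1) prime_elem_dvd_mult_iff by blast
  moreover have "is_unit (of_nat k :: poly3)"
  proof -
    have "of_nat k * const3 (inverse (of_nat k)) = const3 (of_nat k * inverse (of_nat k))"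
      by (simp del: const3_simps(4) add: const3_simps(4)[of "of_nat k"])
    also have "\<dots> = 1" using \<open>k > 0\<close> by (simp del: const3_simps(4))
    finally show ?thesis by (metis dvd_triv_left)
  qed
  ultimately have "h dvd euler h" using dvd_mult_unit_iff' by blast
  then show thesis using euler_dvdD[OF h(1)] that by blast
qed

subsection \<open>Dimension of the space of forms\<close>

definition mon :: "nat \<Rightarrow> nat \<Rightarrow> nat \<Rightarrow> poly3" where
  "mon i j k = monom (monom (monom 1 k) j) i"

lemma coeff3_mon: "coeff3 (mon i j k) a b c = (if a = i \<and> b = j \<and> c = k then 1 else 0)"
  by (auto simp: coeff3_def mon_def)

lemma finite_triangle: "finite {(i, j). i + j \<le> (m::nat)}"
  by (rule finite_subset[of _ "{..m} \<times> {..m}"]) auto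

lemma forms_expand:
  assumes "F \<in> forms (int n)"
  shows "F = (\<Sum>x\<in>{(i, j). i + j \<le> n}. scale (coeff3 F (fst x) (snd x) (n - fst x - snd x))
    (mon (fst x) (snd x) (n - fst x - snd x)))"
proof (rule poly3_eqI)
  fix a b c
  have fin: "finite {(i, j). i + j \<le> n}" by (rule finite_triangle)
  have "(\<Sum>x\<in>{(i, j). i + j \<le> n}. coeff3 F (fst x) (snd x) (n - fst x - snd x) *
        coeff3 (mon (fst x) (snd x) (n - fst x - snd x)) a b c)
      = (\<Sum>x\<in>{(i, j). i + j \<le> n}. if x = (a, b) then (if a + b + c = n then coeff3 F a b c else 0) else 0)"
    by (rule sum.cong) (auto simp: coeff3_mon)
  also have "\<dots> = (if a + b + c = n then coeff3 F a b c else 0)"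
    using fin by (subst sum.delta) auto
  also have "\<dots> = coeff3 F a b c"
    using assms[unfolded forms_iff_coeff3, rule_format, of a b c] by (cases "coeff3 F a b c = 0") auto
  finally show "coeff3 F a b c = coeff3 (\<Sum>x\<in>{(i, j). i + j \<le> n}. scale (coeff3 F (fst x) (snd x) (n - fst x - snd x))
    (mon (fst x) (snd x) (n - fst x - snd x))) a b c"
    by (simp add: coeff3_sum)
qed

lemma card_triangle: "2 * card {(i, j). i + j \<le> n} = (n + 1) * (n + 2)"
proof -
  have "{(i, j). i + j \<le> n} = Sigma {..n} (\<lambda>i. {..n - i})" by auto
  then have "card {(i, j). i + j \<le> n} = (\<Sum>i\<le>n. Suc (n - i))" by simp
  also have "\<dots> = (\<Sum>i\<le>n. Suc i)" by (rule sum.nat_diff_reindex[of "Suc" "Suc n", unfolded lessThan_Suc_atMost, simplified])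
  also have "2 * \<dots> = (n + 1) * (n + 2)" by (induction n) auto
  finally show ?thesis .
qed

lemma forms_subset_span:
  "forms (int m) \<subseteq> S3.span ((\<lambda>x. mon (fst x) (snd x) (m - fst x - snd x)) ` {(i, j). i + j \<le> m})"
  (is "_ \<subseteq> S3.span (?f ` ?I)")
proof
  fix F assume F: "F \<in> forms (int m)"
  show "F \<in> S3.span (?f ` ?I)"
    by (subst forms_expand[OF F]) (intro S3.span_sum S3.span_scale S3.span_base imageI)
qed

lemma finite_span_forms: "S3.finite_span (forms n)"
proof (cases "n \<ge> 0")
  case True
  then obtain m where m: "n = int m" using zero_le_imp_eq_int by blast
  show ?thesis unfolding S3.finite_span_def m using forms_subset_span finite_triangle by blast
next
  case False
  then show ?thesis unfolding S3.finite_span_def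
    using forms_neg[of n] S3.span_zero[of "{}"] by (intro exI[of _ "{}"]) auto
qed

lemma dim_forms:
  assumes "n \<ge> - 2"
  shows "2 * int (S3.dim (forms n)) = (n + 1) * (n + 2)"
proof (cases "n \<ge> 0")
  case True
  then obtain m where m: "n = int m" using zero_le_imp_eq_int by blast
  let ?I = "{(i, j). i + j \<le> m}"
  let ?f = "\<lambda>x. mon (fst x) (snd x) (m - fst x - snd x)"
  have fin: "finite ?I" by (rule finite_triangle)
  have "forms n \<subseteq> S3.span (?f ` ?I)" unfolding m by (rule forms_subset_span)
  then have "S3.dim (forms n) \<le> card ?I"
    using S3.dim_le_card[of "forms n" "?f ` ?I"] card_image_le[of ?I ?f] fin by simp
  moreover have "card ?I + S3.dim {0} \<le> S3.dim (forms n)"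
  proof (rule S3.card_add_dim_le[OF forms_subspace finite_span_forms _ _ fin, where w = ?f])
    show "?f x \<in> forms n" if "x \<in> ?I" for x
      using that unfolding forms_iff_coeff3 by (auto simp: coeff3_mon m)
    fix c x assume s: "(\<Sum>x\<in>?I. scale (c x) (?f x)) \<in> {0}" and x: "x \<in> ?I"
    have "0 = coeff3 (\<Sum>x\<in>?I. scale (c x) (?f x)) (fst x) (snd x) (m - fst x - snd x)"
      using s by (simp add: coeff3_def)
    also have "\<dots> = (\<Sum>y\<in>?I. if y = x then c x else 0)"
      unfolding coeff3_sum by (rule sum.cong) (auto simp: coeff3_mon)
    also have "\<dots> = c x" using fin x by simp
    finally show "c x = 0" by simp
  qed (auto simp: S3.subspace_def)
  ultimately have "S3.dim (forms n) = card ?I" by simp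
  then have "2 * int (S3.dim (forms n)) = int ((m + 1) * (m + 2))" using card_triangle[of m] by presburger
  then show ?thesis by (simp add: m algebra_simps)
next
  case False
  have "S3.dim {0} = 0" using S3.dim_le_card[of "{0}" "{}"] S3.span_zero by simp
  moreover have "(n + 1) * (n + 2) = 0" using assms False by (cases "n = -1") auto
  ultimately show ?thesis using False forms_neg[of n] by simp
qed

subsection \<open>Evaluation\<close>

lemma eval3_simps [simp]:
  "eval3 (F + G) v = eval3 F v + eval3 G v"
  "eval3 (F - G) v = eval3 F v - eval3 G v"
  "eval3 (- F) v = - eval3 F v"
  "eval3 (F * G) v = eval3 F v * eval3 G v"
  "eval3 (const3 c) v = c"
  "eval3 (scale c F) v = c * eval3 F v"
  "eval3 0 v = 0"
  "eval3 1 v = 1"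
  by (simp_all add: eval3_def const3_def scale_def)

lemma eval3_sum [simp]: "eval3 (sum f A) v = (\<Sum>x\<in>A. eval3 (f x) v)"
  by (induction A rule: infinite_finite_induct) simp_all

lemma eval3_prod [simp]: "eval3 (prod f A) v = (\<Prod>x\<in>A. eval3 (f x) v)"
  by (induction A rule: infinite_finite_induct) simp_all

lemma eval3_var [simp]: "eval3 (var i) v = v $ i"
  using exhaust_3[of i] by (auto simp: eval3_def var_def)

lemma gradient_nth: "gradient F v $ i = eval3 (pd i F) v"
  using exhaust_3[of i] by (auto simp: gradient_def pd_def vector_3)

lemma eval3_euler:
  assumes "F \<in> forms n"
  shows "(\<Sum>i\<in>UNIV. v $ i * eval3 (pd i F) v) = of_int n * eval3 F v"
proof -
  have "eval3 (euler F) v = eval3 (const3 (of_int n) * F) v" using assms by (simp add: forms_def)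
  then show ?thesis by (simp add: euler_def del: const3_of_int)
qed

section \<open>Graded ideals\<close>

text \<open>A homogeneous ideal, represented by its homogeneous parts.\<close>

definition graded_ideal :: "(int \<Rightarrow> poly3 set) \<Rightarrow> bool" where
  "graded_ideal K \<longleftrightarrow> (\<forall>n. K n \<subseteq> forms n \<and> S3.subspace (K n)) \<and>
     (\<forall>n k p r. p \<in> K n \<longrightarrow> r \<in> forms k \<longrightarrow> r * p \<in> K (n + k))"

definition ideal_sum :: "(int \<Rightarrow> poly3 set) \<Rightarrow> (int \<Rightarrow> poly3 set) \<Rightarrow> int \<Rightarrow> poly3 set" where
  "ideal_sum K L n = {x + y |x y. x \<in> K n \<and> y \<in> L n}"

text \<open>The multiples of a form \<open>F\<close> of degree \<open>a\<close> by the ideal \<open>K\<close>.\<close>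

definition ideal_mult :: "int \<Rightarrow> poly3 \<Rightarrow> (int \<Rightarrow> poly3 set) \<Rightarrow> int \<Rightarrow> poly3 set" where
  "ideal_mult a F K n = (\<lambda>p. F * p) ` K (n - a)"

lemma graded_idealD:
  assumes "graded_ideal K"
  shows "K n \<subseteq> forms n" "S3.subspace (K n)" "S3.finite_span (K n)"
    "p \<in> K n \<Longrightarrow> r \<in> forms k \<Longrightarrow> r * p \<in> K (n + k)"
  using assms S3.finite_span_subset[OF finite_span_forms] unfolding graded_ideal_def by blast+

lemma graded_ideal_0:
  assumes "graded_ideal K" shows "0 \<in> K n"
  using S3.subspace_0 graded_idealD(2)[OF assms] by blast

lemma graded_ideal_forms: "graded_ideal forms"
  unfolding graded_ideal_def using forms_subspace forms_mult by (auto simp: mult.commute)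

lemma graded_ideal_sum:
  assumes "graded_ideal K" "graded_ideal L"
  shows "graded_ideal (ideal_sum K L)"
  unfolding graded_ideal_def
proof (intro conjI allI impI)
  fix n k p r
  show "ideal_sum K L n \<subseteq> forms n"
    using assms[THEN graded_idealD(1), of n] by (auto simp: ideal_sum_def intro: forms_add)
  show "S3.subspace (ideal_sum K L n)"
    unfolding ideal_sum_def by (intro S3.subspace_sums assms[THEN graded_idealD(2)])
  assume "p \<in> ideal_sum K L n" "r \<in> forms k"
  then show "r * p \<in> ideal_sum K L (n + k)"
    using assms[THEN graded_idealD(4), of _ n r k] unfolding ideal_sum_def
    by (auto simp: distrib_left) blast
qed

lemma linear_mult: "Vector_Spaces.linear scale scale (\<lambda>p. F * p)"
  by unfold_locales (simp_all add: scale_conv algebra_simps)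

lemma graded_ideal_mult:
  assumes "graded_ideal K" "F \<in> forms a"
  shows "graded_ideal (ideal_mult a F K)"
  unfolding graded_ideal_def
proof (intro conjI allI impI)
  fix n k p r
  show "ideal_mult a F K n \<subseteq> forms n"
    using graded_idealD(1)[OF assms(1), of "n - a"] forms_mult[OF assms(2), of _ "n - a"]
    by (auto simp: ideal_mult_def)
  interpret l: Vector_Spaces.linear scale scale "\<lambda>p. F * p" by (rule linear_mult)
  show "S3.subspace (ideal_mult a F K n)"
    unfolding ideal_mult_def by (intro l.subspace_image graded_idealD(2)[OF assms(1)])
  assume "p \<in> ideal_mult a F K n" "r \<in> forms k"
  then obtain q where q: "q \<in> K (n - a)" "p = F * q" unfolding ideal_mult_def by blast
  then have "r * q \<in> K (n - a + k)" using graded_idealD(4)[OF assms(1)] \<open>r \<in> forms k\<close> by blast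
  moreover have "n - a + k = n + k - a" by simp
  ultimately have "F * (r * q) \<in> ideal_mult a F K (n + k)" unfolding ideal_mult_def by (intro imageI) simp
  then show "r * p \<in> ideal_mult a F K (n + k)" using q by (simp add: mult.left_commute)
qed

interpretation S33: vector_space_pair scale scale ..

lemma dim_mult_image:
  assumes "S3.subspace U" "S3.finite_span U" "F \<noteq> 0"
  shows "S3.dim ((\<lambda>p. F * p) ` U) = S3.dim U"
  using S33.dim_image_inj[OF linear_mult assms(1,2), of F] assms(3) by simp

lemma dim_ideal_mult:
  assumes "graded_ideal K" "F \<noteq> 0"
  shows "S3.dim (ideal_mult a F K n) = S3.dim (K (n - a))"
  unfolding ideal_mult_def using dim_mult_image graded_idealD[OF assms(1)] assms(2) by blast

lemma dim_ideal_sum: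
  assumes "graded_ideal K" "graded_ideal L"
  shows "S3.dim (ideal_sum K L n) + S3.dim (K n \<inter> L n) = S3.dim (K n) + S3.dim (L n)"
  unfolding ideal_sum_def using assms by (intro S3.dim_sum_Int graded_idealD)

lemma dim_ideal_le: "graded_ideal K \<Longrightarrow> S3.dim (K n) \<le> S3.dim (forms n)"
  by (intro S3.dim_mono_finite_span finite_span_forms graded_idealD)

lemma ideal_sum_upper:
  assumes "graded_ideal K" "graded_ideal L"
  shows "K n \<subseteq> ideal_sum K L n" "L n \<subseteq> ideal_sum K L n"
  using graded_ideal_0[OF assms(1), of n] graded_ideal_0[OF assms(2), of n]
  unfolding ideal_sum_def by force+

text \<open>Replaces the expansion into monomials in inductions on the degree.\<close>

lemma forms_euler_expand:
  assumes "F \<in> forms n" "n > 0"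
  shows "F = scale (inverse (of_int n)) (\<Sum>i\<in>UNIV. var i * pd i F)"
proof -
  have "euler F = scale (of_int n) F" using assms(1) by (simp add: forms_def scale_conv)
  then have "scale (inverse (of_int n)) (euler F) = F" using assms(2) by simp
  then show ?thesis by (simp add: euler_def)
qed

lemma graded_ideal_full_mono:
  assumes K: "graded_ideal K" and N: "K N = forms N" "0 \<le> N" "N \<le> n"
  shows "K n = forms n"
  using N(3)
proof (induction n rule: int_ge_induct)
  case (step n)
  have "F \<in> K (n + 1)" if F: "F \<in> forms (n + 1)" for F
  proof -
    have "var i * pd i F \<in> K (n + 1)" for i
      using graded_idealD(4)[OF K _ forms_var[of i], of _ n] forms_pd[OF F, of i] step by simp
    then have "scale (inverse (of_int (n + 1))) (\<Sum>i\<in>UNIV. var i * pd i F) \<in> K (n + 1)"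
      by (intro S3.subspace_scale S3.subspace_sum graded_idealD(2)[OF K])
    then show ?thesis using forms_euler_expand[OF F] step N(2) by simp
  qed
  then show ?case using graded_idealD(1)[OF K] by blast
qed (use N in simp)

lemma forms_unique:
  assumes "F \<in> forms n" "F \<in> forms k" "F \<noteq> 0" shows "n = k"
proof -
  have "of_int n * F = of_int k * F" using assms unfolding forms_def by auto
  then show ?thesis using assms(3) by simp
qed

section \<open>The projective Nullstellensatz\<close>

text \<open>The sum is a binary form in \<open>s\<close> and \<open>t\<close>, which over the complex numbers is a product of linear
  forms. They are cancelled one by one.\<close>

lemma binary_form_cancel:
  fixes Z :: "poly3 set"
  assumes lin: "\<And>\<gamma> q. (s - const3 \<gamma> * t) * q \<in> Z \<Longrightarrow> q \<in> Z"
    and t: "\<And>q. t * q \<in> Z \<Longrightarrow> q \<in> Z"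
    and c: "\<And>c q. c \<noteq> 0 \<Longrightarrow> const3 c * q \<in> Z \<Longrightarrow> q \<in> Z"
    and a: "a \<noteq> 0" "degree a \<le> m"
    and Z: "(\<Sum>k\<le>m. const3 (coeff a k) * s ^ k * t ^ (m - k)) * q \<in> Z"
  shows "q \<in> Z"
  using a Z
proof (induction m arbitrary: a)
  case 0
  then have "coeff a 0 \<noteq> 0" using leading_coeff_0_iff[of a] by auto
  then show ?case using 0 c by auto
next
  case (Suc m)
  define H where "H m a = (\<Sum>k\<le>m. const3 (coeff a k) * s ^ k * t ^ (m - k))" for m a
  have H_t: "H (Suc m) b = t * H m b" if "degree b \<le> m" for b
  proof -
    have "coeff b (Suc m) = 0" using that by (simp add: coeff_eq_0)
    then show ?thesis by (simp add: H_def sum_distrib_left Suc_diff_le algebra_simps)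
  qed
  show ?case
  proof (cases "degree a \<le> m")
    case True
    then have "t * (H m a * q) \<in> Z" using Suc.prems(3) H_t[OF True] by (simp add: H_def mult.assoc)
    then show ?thesis using Suc.IH[OF Suc.prems(1) True] t unfolding H_def by blast
  next
    case False
    then have "\<not> constant (poly a)" by (simp add: constant_degree)
    then obtain \<gamma> where "poly a \<gamma> = 0" using fundamental_theorem_of_algebra by blast
    then obtain b where b: "a = [:- \<gamma>, 1:] * b" using poly_eq_0_iff_dvd[of a \<gamma>] by (auto elim: dvdE)
    then have "b \<noteq> 0" using Suc.prems(1) by auto
    then have deg: "degree b \<le> m" using Suc.prems(2) b degree_mult_eq[of "[:- \<gamma>, 1:]" b] by simp
    have "H (Suc m) a = H (Suc m) (pCons 0 b) - const3 \<gamma> * H (Suc m) b"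
      unfolding H_def sum_distrib_left sum_subtractf[symmetric]
      by (rule sum.cong) (simp_all add: b algebra_simps)
    also have "H (Suc m) (pCons 0 b) = s * H m b"
      unfolding H_def by (simp only: sum.atMost_Suc_shift)
        (simp add: sum_distrib_left algebra_simps)
    also have "s * H m b - const3 \<gamma> * H (Suc m) b = (s - const3 \<gamma> * t) * H m b"
      by (simp add: H_t[OF deg] algebra_simps)
    finally have "(s - const3 \<gamma> * t) * (H m b * q) \<in> Z"
      using Suc.prems(3) by (simp add: H_def mult.assoc)
    then show ?thesis using Suc.IH[OF \<open>b \<noteq> 0\<close> deg] lin unfolding H_def by blast
  qed
qed

text \<open>Modulo a suitable ideal \<open>P\<close> above the given one, all variables become multiples of a single
  linear form \<open>l\<close>, and the coefficients of these multiples are the coordinates of a zero. It suffices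
  to choose \<open>P\<close> with as many linear forms as possible: every further linear form then generates,
  together with \<open>P\<close>, all forms of large degree.\<close>

context
  fixes P :: "int \<Rightarrow> poly3 set"
  assumes P: "graded_ideal P"
    and proper: "\<And>n. n \<ge> 0 \<Longrightarrow> P n \<noteq> forms n"
    and maximal: "\<And>Q. graded_ideal Q \<Longrightarrow> (\<And>n. P n \<subseteq> Q n) \<Longrightarrow> (\<And>n. n \<ge> 0 \<Longrightarrow> Q n \<noteq> forms n) \<Longrightarrow>
      S3.dim (Q 1) \<le> S3.dim (P 1)"
begin

lemma linear_form_onto:
  assumes l: "l \<in> forms 1" "l \<notin> P 1"
  obtains N where "N \<ge> 0" "\<And>n. n \<ge> N \<Longrightarrow> ideal_sum P (ideal_mult 1 l forms) n = forms n"
proof -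
  let ?L = "ideal_mult 1 l forms"
  let ?Q = "ideal_sum P ?L"
  have L: "graded_ideal ?L" by (rule graded_ideal_mult[OF graded_ideal_forms l(1)])
  have Q: "graded_ideal ?Q" by (rule graded_ideal_sum[OF P L])
  have "l \<in> ?L 1" unfolding ideal_mult_def using forms_1 by force
  then have lQ: "l \<in> ?Q 1" using ideal_sum_upper(2)[OF P L] by blast
  have "\<not> S3.dim (?Q 1) \<le> S3.dim (P 1)"
  proof
    assume "S3.dim (?Q 1) \<le> S3.dim (P 1)"
    then have "P 1 = ?Q 1"
      by (intro S3.subspace_eq_of_dim_le graded_idealD[OF Q] graded_idealD[OF P] ideal_sum_upper[OF P L])
    then show False using lQ l(2) by simp
  qed
  then obtain N where "N \<ge> 0" "?Q N = forms N"
    using maximal[OF Q ideal_sum_upper(1)[OF P L]] by blast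
  then show thesis using that[of N] graded_ideal_full_mono[OF Q] by blast
qed

text \<open>Otherwise \<open>P\<close> would contain all forms of large degree, as these are multiples of \<open>l ^ k\<close> modulo
  \<open>P\<close>.\<close>

lemma power_notin:
  assumes l: "l \<in> forms 1" "l \<notin> P 1"
  shows "l ^ k \<notin> P (int k)"
proof
  assume k: "l ^ k \<in> P (int k)"
  obtain N where N: "N \<ge> 0" "\<And>n. n \<ge> N \<Longrightarrow> ideal_sum P (ideal_mult 1 l forms) n = forms n"
    using linear_form_onto[OF l] by blast
  have "\<exists>p \<in> P (N + int j). \<exists>r \<in> forms N. F = p + l ^ j * r" if "F \<in> forms (N + int j)" for F j
    using that
  proof (induction j arbitrary: F)
    case 0
    then show ?case using graded_ideal_0[OF P, of N] by (intro bexI[of _ 0] bexI[of _ F]) auto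
  next
    case (Suc j)
    then have "F \<in> ideal_sum P (ideal_mult 1 l forms) (N + int (Suc j))" using N(2) by simp
    then obtain p r where pr: "p \<in> P (N + int (Suc j))" "r \<in> forms (N + int j)" "F = p + l * r"
      by (auto simp: ideal_sum_def ideal_mult_def)
    obtain p' r' where pr': "p' \<in> P (N + int j)" "r' \<in> forms N" "r = p' + l ^ j * r'"
      using Suc.IH[OF pr(2)] by blast
    have "l * p' \<in> P (N + int (Suc j))" using graded_idealD(4)[OF P pr'(1) l(1)] by (simp add: algebra_simps)
    then have "p + l * p' \<in> P (N + int (Suc j))" using pr(1) S3.subspace_add[OF graded_idealD(2)[OF P]] by blast
    then show ?case using pr' pr(3) by (intro bexI[of _ "p + l * p'"] bexI[of _ r']) (auto simp: algebra_simps)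
  qed
  moreover have "r * l ^ k \<in> P (N + int k)" if "r \<in> forms N" for r
    using graded_idealD(4)[OF P k that] by (simp add: algebra_simps)
  ultimately have "forms (N + int k) \<subseteq> P (N + int k)"
    using S3.subspace_add[OF graded_idealD(2)[OF P]] by (metis mult.commute subsetI)
  then show False using proper[of "N + int k"] graded_idealD(1)[OF P, of "N + int k"] N(1) by auto
qed

text \<open>Multiplication by \<open>l\<close> is onto modulo \<open>P\<close> in large degrees, so the codimension of \<open>P\<close> is
  eventually constant, and then the multiplication is also injective.\<close>

lemma linear_form_inj:
  assumes l: "l \<in> forms 1" "l \<notin> P 1"
  obtains N b where "N \<ge> 0" "\<And>n F. n \<ge> N \<Longrightarrow> F \<in> forms n \<Longrightarrow> l * F \<in> P (n + 1) \<Longrightarrow> F \<in> P n"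
    "\<And>n. n \<ge> N \<Longrightarrow> S3.dim (forms n) \<le> S3.dim (P n) + b"
proof -
  obtain N where N: "N \<ge> 0" "\<And>n. n \<ge> N \<Longrightarrow> ideal_sum P (ideal_mult 1 l forms) n = forms n"
    using linear_form_onto[OF l] by blast
  let ?L = "ideal_mult 1 l forms"
  have l0: "l \<noteq> 0" using l(2) graded_ideal_0[OF P] by blast
  have L: "graded_ideal ?L" by (rule graded_ideal_mult[OF graded_ideal_forms l(1)])
  define R where "R n = P (n + 1) \<inter> ?L (n + 1)" for n
  have R: "S3.finite_span (R n)" for n
    unfolding R_def using S3.finite_span_subset[OF graded_idealD(3)[OF P]] by blast
  have sub: "(\<lambda>p. l * p) ` P n \<subseteq> R n" for n
    using graded_idealD(1)[OF P, of n] graded_idealD(4)[OF P _ l(1), of _ n]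
    by (auto simp: R_def ideal_mult_def)
  have dimP: "S3.dim ((\<lambda>p. l * p) ` P n) = S3.dim (P n)" for n
    by (intro dim_mult_image graded_idealD[OF P] l0)
  define c where "c n = S3.dim (forms n) - S3.dim (P n)" for n
  have le: "S3.dim (P n) \<le> S3.dim (forms n)" for n by (rule dim_ideal_le[OF P])
  have RP: "S3.dim (P n) \<le> S3.dim (R n)" for n
    using S3.dim_mono_finite_span[OF R sub] dimP by simp
  have step: "c (n + 1) + (S3.dim (R n) - S3.dim (P n)) = c n" if "n \<ge> N" for n
    using dim_ideal_sum[OF P L, of "n + 1"] N(2)[of "n + 1"] that RP[of n] le[of n] le[of "n + 1"]
    by (simp add: c_def R_def dim_ideal_mult[OF graded_ideal_forms l0])
  define f where "f k = c (N + int k)" for k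
  have dec: "decseq f"
    by (rule decseq_SucI) (use step in \<open>simp add: f_def algebra_simps\<close>, metis add.commute le_add1 le_add_same_cancel1 of_nat_0_le_iff)
  obtain k0 where k0: "\<And>k. f k0 \<le> f k" using ex_has_least_nat[of "\<lambda>_. True" _ f] by auto
  then have const: "f k = f k0" if "k \<ge> k0" for k
    using decseqD[OF dec that] by (simp add: antisym)
  show thesis
  proof (rule that[of "N + int k0" "f 0"])
    fix n assume n: "n \<ge> N + int k0"
    then obtain k where k: "n = N + int k" "k \<ge> k0"
      by (metis add.commute add_diff_cancel_left' le_add_same_cancel1 le_diff_eq nat_int nat_le_iff of_nat_0_le_iff order_trans zle_iff_zadd)
    show "S3.dim (forms n) \<le> S3.dim (P n) + f 0"
      using decseqD[OF dec, of 0 k] le[of n] unfolding f_def c_def k(1) by simp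
    fix F assume F: "F \<in> forms n" "l * F \<in> P (n + 1)"
    have "c n = c (n + 1)" using const[of k] const[of "Suc k"] k by (simp add: f_def algebra_simps)
    then have "S3.dim (R n) \<le> S3.dim (P n)" using step[of n] n by simp
    moreover have "S3.subspace ((\<lambda>p. l * p) ` P n)"
    proof -
      interpret lm: Vector_Spaces.linear scale scale "\<lambda>p. l * p" by (rule linear_mult)
      show ?thesis by (intro lm.subspace_image graded_idealD[OF P])
    qed
    ultimately have "(\<lambda>p. l * p) ` P n = R n"
      using S3.subspace_eq_of_dim_le[OF R sub] dimP by simp
    moreover have "l * F \<in> R n" using F by (auto simp: R_def ideal_mult_def)
    ultimately have "l * F \<in> (\<lambda>p. l * p) ` P n" by simp
    then show "F \<in> P n" using l0 by (auto simp del: mult_cancel_left simp add: mult_left_cancel)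
  qed (use N in auto)
qed

text \<open>Many products \<open>x ^ k * l ^ (m - k)\<close> satisfy a linear relation modulo \<open>P\<close>.
  The relation is a binary form in \<open>x\<close> and \<open>l\<close>, a product of linear forms. If no factor were
  in \<open>P\<close>, they could be cancelled one after the other.\<close>

lemma linear_form_congruent:
  assumes l: "l \<in> forms 1" "l \<notin> P 1" and x: "x \<in> forms 1"
  obtains \<gamma> where "x - const3 \<gamma> * l \<in> P 1"
proof -
  have False if no: "\<And>\<gamma>. x - const3 \<gamma> * l \<notin> P 1"
  proof -
    obtain N b where N: "N \<ge> 0" "\<And>n. n \<ge> N \<Longrightarrow> S3.dim (forms n) \<le> S3.dim (P n) + b"
      using linear_form_inj[OF l] by metis
    define m where "m = nat N + b"
    have m: "int m \<ge> N" "m \<ge> b" using N(1) by (auto simp: m_def)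
    let ?w = "\<lambda>k. x ^ k * l ^ (m - k)"
    have w: "?w k \<in> forms (int m)" if "k \<in> {..m}" for k
      using forms_mult[OF forms_power[OF x, of k] forms_power[OF l(1), of "m - k"]] that
      by (simp add: of_nat_diff)
    have "\<not> (\<forall>c i. (\<Sum>k\<le>m. scale (c k) (?w k)) \<in> P (int m) \<longrightarrow> i \<in> {..m} \<longrightarrow> c i = 0)"
    proof
      assume "\<forall>c i. (\<Sum>k\<le>m. scale (c k) (?w k)) \<in> P (int m) \<longrightarrow> i \<in> {..m} \<longrightarrow> c i = 0"
      then have "card {..m} + S3.dim (P (int m)) \<le> S3.dim (forms (int m))"
        by (intro S3.card_add_dim_le[where w = ?w] forms_subspace finite_span_forms graded_idealD[OF P] w) auto
      then show False using N(2)[OF m(1)] m(2) by simp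
    qed
    then obtain c i where c: "(\<Sum>k\<le>m. scale (c k) (?w k)) \<in> P (int m)" "i \<le> m" "c i \<noteq> 0" by auto
    define a where "a = (\<Sum>k\<le>m. monom (c k) k)"
    have coeff_a: "coeff a k = (if k \<le> m then c k else 0)" for k
      by (simp add: a_def coeff_sum)
    define Z where "Z = {q. \<exists>k n. l ^ k * q \<in> P n}"
    have "(1::poly3) \<in> Z"
    proof (rule binary_form_cancel[where s = x and t = l and a = a and m = m])
      fix \<gamma> q assume "(x - const3 \<gamma> * l) * q \<in> Z"
      then obtain k n where kn: "l ^ k * ((x - const3 \<gamma> * l) * q) \<in> P n" unfolding Z_def by blast
      let ?l = "x - const3 \<gamma> * l"
      have l': "?l \<in> forms 1" "?l \<notin> P 1"
        using forms_diff[OF x forms_scale[OF l(1), of \<gamma>]] no by (auto simp: scale_conv)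
      then have l0: "?l \<noteq> 0" using graded_ideal_0[OF P] by metis
      obtain N' where N': "\<And>n F. n \<ge> N' \<Longrightarrow> F \<in> forms n \<Longrightarrow> ?l * F \<in> P (n + 1) \<Longrightarrow> F \<in> P n"
        using linear_form_inj[OF l'] by metis
      define j where "j = nat (N' - n + 1)"
      have "l ^ j * (l ^ k * (?l * q)) \<in> P (n + int j)"
        using graded_idealD(4)[OF P kn forms_power[OF l(1), of j]] by simp
      also have "l ^ j * (l ^ k * (?l * q)) = ?l * (l ^ (j + k) * q)"
        by (simp only: power_add mult_ac)
      finally have *: "?l * (l ^ (j + k) * q) \<in> P (n + int j)" .
      then have "l ^ (j + k) * q \<in> forms (n + int j - 1)"
        using forms_divide[OF l0 l'(1)] graded_idealD(1)[OF P] by blast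
      moreover have "n + int j - 1 \<ge> N'" by (simp add: j_def)
      ultimately have "l ^ (j + k) * q \<in> P (n + int j - 1)" using N' * by simp
      then show "q \<in> Z" unfolding Z_def by blast
    next
      fix q assume "l * q \<in> Z"
      then obtain k n where "l ^ k * (l * q) \<in> P n" unfolding Z_def by blast
      then have "l ^ Suc k * q \<in> P n" by (simp add: mult_ac)
      then show "q \<in> Z" unfolding Z_def by blast
    next
      fix c q assume c: "c \<noteq> 0" "const3 c * q \<in> Z"
      then obtain k n where "l ^ k * (const3 c * q) \<in> P n" unfolding Z_def by blast
      then have "scale (inverse c) (l ^ k * (const3 c * q)) \<in> P n"
        by (intro S3.subspace_scale graded_idealD[OF P])
      moreover have "scale (inverse c) (l ^ k * (const3 c * q)) = scale (inverse c) (scale c (l ^ k * q))"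
        by (simp add: scale_conv mult_ac)
      ultimately have "l ^ k * q \<in> P n" using c(1) by simp
      then show "q \<in> Z" unfolding Z_def by blast
    next
      show "a \<noteq> 0" using coeff_a[of i] c(2,3) by auto
      show "degree a \<le> m" by (rule degree_le) (simp add: coeff_a)
      have "(\<Sum>k\<le>m. const3 (coeff a k) * x ^ k * l ^ (m - k)) \<in> P (int m)"
        using c(1) by (simp add: coeff_a scale_conv mult.assoc)
      then have "l ^ 0 * (\<Sum>k\<le>m. const3 (coeff a k) * x ^ k * l ^ (m - k)) \<in> P (int m)" by simp
      then show "(\<Sum>k\<le>m. const3 (coeff a k) * x ^ k * l ^ (m - k)) * 1 \<in> Z" unfolding Z_def mult_1_right by blast
    qed
    then obtain k n where kn: "l ^ k \<in> P n" unfolding Z_def by auto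
    have "l \<noteq> 0" using l(2) graded_ideal_0[OF P] by blast
    moreover have "l ^ k \<in> forms n" "l ^ k \<in> forms (int k)"
      using kn graded_idealD(1)[OF P] forms_power[OF l(1), of k] by auto
    ultimately have "n = int k" using forms_unique by simp
    then show False using kn power_notin[OF l] by blast
  qed
  then show thesis using that by blast
qed

text \<open>If each variable is congruent to \<open>v $ i\<close> times \<open>l\<close>, then each form \<open>F\<close> of degree \<open>n\<close> is congruent
  to its value at \<open>v\<close> times \<open>l ^ n\<close>, and \<open>l ^ n\<close> is not in \<open>P\<close>.\<close>

lemma common_zero: "\<exists>v. v \<noteq> 0 \<and> (\<forall>n. \<forall>F\<in>P n. eval3 F v = 0)"
proof -
  obtain l where l: "l \<in> forms 1" "l \<notin> P 1" using proper[of 1] graded_idealD(1)[OF P, of 1] by auto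
  have "\<exists>\<gamma>. var i - const3 \<gamma> * l \<in> P 1" for i
    using linear_form_congruent[OF l forms_var[of i]] by blast
  then obtain g where g: "\<And>i. var i - const3 (g i) * l \<in> P 1" by metis
  define v where "v = (\<chi> i. g i)"
  have v: "var i - const3 (v $ i) * l \<in> P 1" for i using g by (simp add: v_def)
  have "v \<noteq> 0"
  proof
    assume "v = 0"
    then have "pd i l * var i \<in> P 1" for i
      using v[of i] graded_idealD(4)[OF P _ forms_pd[OF l(1), of i], of "var i" 1] by simp
    then have "(\<Sum>i\<in>UNIV. var i * pd i l) \<in> P 1"
      by (intro S3.subspace_sum graded_idealD[OF P]) (simp add: mult.commute)
    then show False using l unfolding forms_def by (simp add: euler_def)
  qed
  moreover have cong: "F - const3 (eval3 F v) * l ^ n \<in> P (int n)" if "F \<in> forms (int n)" for F n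
    using that
  proof (induction n arbitrary: F)
    case 0
    then obtain c where "F = const3 c" using forms_zeroD by auto
    then show ?case using graded_ideal_0[OF P] by simp
  next
    case (Suc n)
    let ?u = "\<lambda>i. pd i F - const3 (eval3 (pd i F) v) * l ^ n"
    let ?N = "of_int (int (Suc n)) :: complex"
    have pF: "pd i F \<in> forms (int n)" for i using forms_pd[OF Suc.prems, of i] by simp
    have 1: "var i * ?u i \<in> P (int (Suc n))" for i
      using graded_idealD(4)[OF P Suc.IH[OF pF[of i]] forms_var[of i]] by (simp add: add.commute)
    have 2: "(const3 (eval3 (pd i F) v) * l ^ n) * (var i - const3 (v $ i) * l) \<in> P (int (Suc n))" for i
      using graded_idealD(4)[OF P v[of i] forms_scale[OF forms_power[OF l(1), of n]], of "eval3 (pd i F) v"]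
      by (simp add: add.commute scale_conv)
    have "scale (inverse ?N) (\<Sum>i\<in>UNIV. var i * ?u i +
        (const3 (eval3 (pd i F) v) * l ^ n) * (var i - const3 (v $ i) * l)) \<in> P (int (Suc n))" (is "?S \<in> _")
      by (intro S3.subspace_scale S3.subspace_sum S3.subspace_add graded_idealD[OF P] 1 2)
    also have "?S = scale (inverse ?N) (\<Sum>i\<in>UNIV. var i * pd i F)
        - scale (inverse ?N) (const3 (\<Sum>i\<in>UNIV. v $ i * eval3 (pd i F) v) * l ^ Suc n)"
      by (simp add: sum_3 scale_conv algebra_simps)
    also have "scale (inverse ?N) (\<Sum>i\<in>UNIV. var i * pd i F) = F"
      using forms_euler_expand[OF Suc.prems] by simp
    also have "(\<Sum>i\<in>UNIV. v $ i * eval3 (pd i F) v) = ?N * eval3 F v"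
      using eval3_euler[OF Suc.prems] by simp
    also have "scale (inverse ?N) (const3 (?N * eval3 F v) * l ^ Suc n) = scale (inverse ?N) (scale ?N (const3 (eval3 F v) * l ^ Suc n))"
      by (simp add: scale_conv mult_ac del: of_int_of_nat_eq)
    also have "\<dots> = const3 (eval3 F v) * l ^ Suc n"
      by (subst S3.scale_scale) (simp del: of_nat_Suc)
    finally show ?case .
  qed
  have "eval3 F v = 0" if F: "F \<in> P n" for n F
  proof (rule ccontr)
    assume e: "eval3 F v \<noteq> 0"
    have Fn: "F \<in> forms n" using F graded_idealD(1)[OF P] by blast
    then have "n \<ge> 0" using forms_neg[of n] e by (cases "n < 0") auto
    then obtain m where m: "n = int m" using zero_le_imp_eq_int by blast
    have "F - (F - const3 (eval3 F v) * l ^ m) \<in> P n"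
      using S3.subspace_diff[OF graded_idealD(2)[OF P] F] cong Fn unfolding m by blast
    then have "scale (eval3 F v) (l ^ m) \<in> P n" by (simp add: scale_conv)
    then have "scale (inverse (eval3 F v)) (scale (eval3 F v) (l ^ m)) \<in> P n"
      by (rule S3.subspace_scale[OF graded_idealD(2)[OF P]])
    then show False using power_notin[OF l, of m] e m by simp
  qed
  ultimately show ?thesis by blast
qed

end

theorem projective_nullstellensatz:
  assumes J: "graded_ideal J" "\<And>n. n \<ge> 0 \<Longrightarrow> J n \<noteq> forms n"
  obtains v where "v \<noteq> 0" "\<And>n F. F \<in> J n \<Longrightarrow> eval3 F v = 0"
proof -
  let ?good = "\<lambda>P. graded_ideal P \<and> (\<forall>n. J n \<subseteq> P n) \<and> (\<forall>n\<ge>0. P n \<noteq> forms n)"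
  have "\<exists>P. ?good P \<and> (\<forall>Q. ?good Q \<longrightarrow> S3.dim (Q 1) \<le> S3.dim (P 1))"
    by (rule ex_has_greatest_nat[where k = J and b = "Suc (S3.dim (forms 1))"])
      (use J in \<open>auto simp: less_Suc_eq_le intro: dim_ideal_le\<close>)
  then obtain P where P: "?good P" "\<And>Q. ?good Q \<Longrightarrow> S3.dim (Q 1) \<le> S3.dim (P 1)" by blast
  have "\<exists>v. v \<noteq> 0 \<and> (\<forall>n. \<forall>F\<in>P n. eval3 F v = 0)"
  proof (rule common_zero)
    show "S3.dim (Q 1) \<le> S3.dim (P 1)"
      if "graded_ideal Q" "\<And>n. P n \<subseteq> Q n" "\<And>n. n \<ge> 0 \<Longrightarrow> Q n \<noteq> forms n" for Q
      using P that by (meson order_trans)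
  qed (use P in auto)
  then show thesis using that P(1) by (meson subsetD)
qed

section \<open>Codimension of ideals containing the partial derivatives\<close>

lemma ideal_multI: "p \<in> K (n - a) \<Longrightarrow> F * p \<in> ideal_mult a F K n"
  unfolding ideal_mult_def by (rule imageI)

definition codim_ge :: "(int \<Rightarrow> poly3 set) \<Rightarrow> int \<Rightarrow> bool" where
  "codim_ge K w \<longleftrightarrow> (\<exists>n0. \<forall>n\<ge>n0. int (S3.dim (K n)) + w \<le> int (S3.dim (forms n)))"

text \<open>The two ideals meet at least in the multiples of \<open>x * F\<close>, and the dimensions of the spaces of forms
  contribute the intersection number \<open>a * D\<close> of the curves \<open>x\<close> and \<open>F\<close>.\<close>

lemma codim_ge_step:
  assumes K: "graded_ideal K" "codim_ge K w" and F: "F \<in> K D" "F \<noteq> 0" and x: "x \<in> forms a" "x \<noteq> 0"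
  shows "codim_ge (ideal_sum (ideal_mult a x K) (ideal_mult D F forms)) (w + a * D)"
proof -
  obtain n0 where n0: "\<And>n. n \<ge> n0 \<Longrightarrow> int (S3.dim (K n)) + w \<le> int (S3.dim (forms n))"
    using K(2) unfolding codim_ge_def by blast
  have FD: "F \<in> forms D" using F(1) graded_idealD(1)[OF K(1)] by blast
  let ?A = "ideal_mult a x K" and ?B = "ideal_mult D F forms"
  have A: "graded_ideal ?A" and B: "graded_ideal ?B"
    using graded_ideal_mult K(1) x(1) graded_ideal_forms FD by blast+
  show ?thesis unfolding codim_ge_def
  proof (intro exI allI impI)
    fix n assume n: "n \<ge> \<bar>n0\<bar> + \<bar>a\<bar> + \<bar>D\<bar>"
    have "(\<lambda>p. (x * F) * p) ` forms (n - a - D) \<subseteq> ?A n \<inter> ?B n"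
    proof clarify
      fix r assume r: "r \<in> forms (n - a - D)"
      have "r * F \<in> K (n - a)" using graded_idealD(4)[OF K(1) F(1) r] by simp
      moreover have "x * r \<in> forms (n - D)" using forms_mult[OF x(1) r] by (simp add: algebra_simps)
      ultimately have "x * (r * F) \<in> ?A n" "F * (x * r) \<in> ?B n" by (auto intro: ideal_multI)
      then show "x * F * r \<in> ?A n \<inter> ?B n" by (simp add: mult_ac)
    qed
    then have "S3.dim ((\<lambda>p. (x * F) * p) ` forms (n - a - D)) \<le> S3.dim (?A n \<inter> ?B n)"
      by (intro S3.dim_mono_finite_span S3.finite_span_subset[OF graded_idealD(3)[OF A, of n]]) auto
    then have "S3.dim (forms (n - a - D)) \<le> S3.dim (?A n \<inter> ?B n)"
      using dim_mult_image[OF forms_subspace finite_span_forms, of "x * F"] F(2) x(2) by simp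
    moreover have "S3.dim (ideal_sum ?A ?B n) + S3.dim (?A n \<inter> ?B n)
        = S3.dim (K (n - a)) + S3.dim (forms (n - D))"
      using dim_ideal_sum[OF A B, of n] dim_ideal_mult[OF K(1) x(2)]
        dim_ideal_mult[OF graded_ideal_forms F(2)] by simp
    moreover have "int (S3.dim (K (n - a))) + w \<le> int (S3.dim (forms (n - a)))"
      using n0[of "n - a"] n by simp
    moreover have "2 * int (S3.dim (forms n)) = (n + 1) * (n + 2)"
      "2 * int (S3.dim (forms (n - a))) = (n - a + 1) * (n - a + 2)"
      "2 * int (S3.dim (forms (n - D))) = (n - D + 1) * (n - D + 2)"
      "2 * int (S3.dim (forms (n - a - D))) = (n - a - D + 1) * (n - a - D + 2)"
      using n by (intro dim_forms; linarith)+
    moreover have "(n + 1) * (n + 2) - (n - a + 1) * (n - a + 2) - (n - D + 1) * (n - D + 2)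
        + (n - a - D + 1) * (n - a - D + 2) = 2 * (a * D)"
      by (simp add: algebra_simps)
    ultimately show "int (S3.dim (ideal_sum ?A ?B n)) + (w + a * D) \<le> int (S3.dim (forms n))"
      by linarith
  qed
qed

lemma codim_ge_two_forms:
  assumes "x \<in> forms a" "x \<noteq> 0" "F \<in> forms D" "F \<noteq> 0"
  shows "codim_ge (ideal_sum (ideal_mult a x forms) (ideal_mult D F forms)) (a * D)"
  using codim_ge_step[OF graded_ideal_forms _ assms(3,4,1,2), of 0] by (simp add: codim_ge_def)

text \<open>A weak form of Bezout: the ideal of the two forms has positive codimension.\<close>

lemma forms_two_common_zero:
  assumes "x \<in> forms a" "x \<noteq> 0" "a > 0" "F \<in> forms D" "F \<noteq> 0" "D > 0"
  obtains v where "v \<noteq> 0" "eval3 x v = 0" "eval3 F v = 0"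
proof -
  let ?A = "ideal_mult a x forms" and ?B = "ideal_mult D F forms"
  have A: "graded_ideal ?A" and B: "graded_ideal ?B"
    using graded_ideal_mult assms graded_ideal_forms by blast+
  have J: "graded_ideal (ideal_sum ?A ?B)" by (rule graded_ideal_sum[OF A B])
  obtain n0 where n0: "\<And>n. n \<ge> n0 \<Longrightarrow> int (S3.dim (ideal_sum ?A ?B n)) + a * D \<le> int (S3.dim (forms n))"
    using codim_ge_two_forms[OF assms(1,2,4,5)] unfolding codim_ge_def by blast
  have proper: "ideal_sum ?A ?B n \<noteq> forms n" if "n \<ge> 0" for n
  proof
    assume "ideal_sum ?A ?B n = forms n"
    then have "ideal_sum ?A ?B (max n n0) = forms (max n n0)"
      using graded_ideal_full_mono[OF J _ that, of "max n n0"] by simp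
    then show False using n0[of "max n n0"] mult_pos_pos[OF assms(3,6)] by simp
  qed
  obtain v where v: "v \<noteq> 0" "\<And>n G. G \<in> ideal_sum ?A ?B n \<Longrightarrow> eval3 G v = 0"
    using projective_nullstellensatz[OF J proper] by blast
  have "x \<in> ?A a" "F \<in> ?B D" unfolding ideal_mult_def using forms_1 by force+
  then show thesis using that[OF v(1)] v(2) ideal_sum_upper[OF A B] by blast
qed

text \<open>The singular points of \<open>F\<close>, as the zeros of an ideal that contains the derivatives, account for a
  multiplicity of at least \<open>w\<close>.\<close>

definition sing_bound :: "poly3 \<Rightarrow> int \<Rightarrow> int \<Rightarrow> bool" where
  "sing_bound F D w \<longleftrightarrow>
     (\<exists>K. graded_ideal K \<and> (\<forall>i. pd i F \<in> K (D - 1)) \<and> codim_ge K w)"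

lemma sing_bound_mono: "sing_bound F D w \<Longrightarrow> w' \<le> w \<Longrightarrow> sing_bound F D w'"
  unfolding sing_bound_def codim_ge_def by (meson add_left_mono order_trans)

text \<open>Here \<open>K\<close> is generated by the quotients of the product by its factors. Adding a factor \<open>x\<close> of
  degree \<open>a\<close> replaces \<open>K\<close> by \<open>x * K\<close> plus the multiples of the old product, and increases \<open>w\<close> by
  \<open>a * D\<close>. The final \<open>2 * w\<close> is \<open>D\<^sup>2\<close> minus the sum of all \<open>a\<^sup>2\<close>, where
  \<open>a\<^sup>2 \<le> 2 * a\<close>.\<close>

lemma product_of_lines_and_conics_bound:
  assumes "\<And>x. x \<in> set xs \<Longrightarrow> x \<noteq> 0 \<and> (x \<in> forms 1 \<or> x \<in> forms 2)"
  shows "\<exists>D K w. D \<ge> 0 \<and> prod_list xs \<in> K D \<and> D\<^sup>2 - 2 * D \<le> 2 * w \<and> graded_ideal K \<and>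
     (\<forall>i. pd i (prod_list xs) \<in> K (D - 1)) \<and> codim_ge K w"
  using assms
proof (induction xs)
  case Nil
  show ?case
    by (intro exI[of _ 0] exI[of _ forms])
      (auto simp: forms_1 graded_ideal_forms codim_ge_def)
next
  case (Cons x xs)
  then obtain D K w where DK: "D \<ge> 0" "prod_list xs \<in> K D" "D\<^sup>2 - 2 * D \<le> 2 * w" "graded_ideal K"
     "\<And>i. pd i (prod_list xs) \<in> K (D - 1)" "codim_ge K w"
    by (metis list.set_intros(2))
  obtain a where x: "x \<noteq> 0" "x \<in> forms a" "a = 1 \<or> a = 2" using Cons.prems[of x] by auto
  let ?F = "prod_list xs"
  have F0: "?F \<noteq> 0" using Cons.prems by (auto simp: prod_list_zero_iff)
  have FD: "?F \<in> forms D" using DK(2) graded_idealD(1)[OF DK(4)] by blast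
  let ?A = "ideal_mult a x K" and ?B = "ideal_mult D ?F forms"
  have A: "graded_ideal ?A" and B: "graded_ideal ?B"
    using graded_ideal_mult DK(4) x(2) graded_ideal_forms FD by blast+
  have J: "graded_ideal (ideal_sum ?A ?B)" by (rule graded_ideal_sum[OF A B])
  have "x * ?F \<in> ?A (a + D)" using DK(2) by (intro ideal_multI) simp
  then have 1: "x * ?F \<in> ideal_sum ?A ?B (a + D)" using ideal_sum_upper[OF A B] by blast
  have "pd i (x * ?F) \<in> ideal_sum ?A ?B (a + D - 1)" for i
  proof -
    have "x * pd i ?F \<in> ?A (a + D - 1)" unfolding ideal_mult_def
      by (rule imageI) (use DK(5)[of i] in \<open>simp add: algebra_simps\<close>)
    moreover have "?F * pd i x \<in> ?B (a + D - 1)" unfolding ideal_mult_def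
      by (rule imageI) (use forms_pd[OF x(2), of i] in \<open>simp add: algebra_simps\<close>)
    ultimately show ?thesis by (auto simp: ideal_sum_def pd_mult mult.commute add.commute)
  qed
  moreover have "(a + D)\<^sup>2 - 2 * (a + D) \<le> 2 * (w + a * D)"
    using DK(3) x(3) by (auto simp: power2_eq_square algebra_simps)
  ultimately show ?case using 1 DK(1) x(3) J codim_ge_step[OF DK(4,6,2) F0 x(2,1)]
    by (intro exI[of _ "a + D"] exI[of _ "ideal_sum ?A ?B"] exI[of _ "w + a * D"]) auto
qed

text \<open>The hypothesis on \<open>v\<close> makes one partial derivative a combination of the other two, and an
  ideal generated by two forms of degree \<open>e\<close> has codimension at least \<open>e * e\<close>.\<close>

lemma cone_bound:
  assumes F: "F \<in> forms (int e + 1)" and v: "v \<noteq> 0" "(\<Sum>i\<in>UNIV. scale (v $ i) (pd i F)) = 0"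
  shows "sing_bound F (int e + 1) (int e * int e)"
proof -
  obtain c where c: "v $ c \<noteq> 0" using v(1) by (auto simp: vec_eq_iff)
  define a :: 3 where "a = (if c = 1 then 2 else 1)"
  define b :: 3 where "b = (if c = 3 then 2 else 3)"
  have abc: "a \<noteq> b" "a \<noteq> c" "b \<noteq> c" "\<And>i. i = a \<or> i = b \<or> i = c"
    using exhaust_3[of c] exhaust_3 by (auto simp: a_def b_def)
  have U: "(UNIV :: 3 set) = {a, b, c}" using abc(4) by auto
  have s: "scale (v $ a) (pd a F) + (scale (v $ b) (pd b F) + scale (v $ c) (pd c F)) = 0"
    using v(2) abc(1-3) by (simp add: U)
  \<comment> \<open>A vanishing derivative is replaced by an arbitrary nonzero form, which only enlarges the ideal.\<close>
  define nz where "nz u = (if u = 0 then var 1 ^ e else u)" for u :: poly3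
  have "var 1 \<noteq> 0" by (simp add: var_def)
  then have nz0: "nz u \<noteq> 0" for u by (simp add: nz_def)
  have pF: "pd i F \<in> forms (int e)" for i using forms_pd[OF F, of i] by simp
  have nzF: "nz (pd i F) \<in> forms (int e)" for i
    using pF[of i] forms_power[OF forms_var, of 1 e] by (simp add: nz_def)
  let ?A = "ideal_mult (int e) (nz (pd a F)) forms" and ?B = "ideal_mult (int e) (nz (pd b F)) forms"
  let ?K = "ideal_sum ?A ?B"
  have A: "graded_ideal ?A" and B: "graded_ideal ?B"
    using graded_ideal_mult graded_ideal_forms nzF by blast+
  have K: "graded_ideal ?K" by (rule graded_ideal_sum[OF A B])
  have "nz (pd a F) \<in> ?A (int e)" "nz (pd b F) \<in> ?B (int e)" unfolding ideal_mult_def using forms_1 by force+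
  then have "nz (pd a F) \<in> ?K (int e)" "nz (pd b F) \<in> ?K (int e)" using ideal_sum_upper[OF A B] by blast+
  then have ab: "pd a F \<in> ?K (int e)" "pd b F \<in> ?K (int e)"
    using graded_ideal_0[OF K] by (auto simp: nz_def split: if_splits)
  have "scale (v $ c) (pd c F) = - (scale (v $ a) (pd a F) + scale (v $ b) (pd b F))"
    using s by (simp only: eq_neg_iff_add_eq_0 add_ac)
  then have "scale (v $ c) (pd c F) \<in> ?K (int e)"
    using ab by (simp only:) (intro S3.subspace_neg S3.subspace_add S3.subspace_scale graded_idealD(2)[OF K])
  then have "scale (inverse (v $ c)) (scale (v $ c) (pd c F)) \<in> ?K (int e)"
    by (rule S3.subspace_scale[OF graded_idealD(2)[OF K]])
  then have pc: "pd c F \<in> ?K (int e)" using c by simp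
  have "pd i F \<in> ?K (int e)" for i
    using abc(4)[of i] by (elim disjE; hypsubst) (rule ab(1) ab(2) pc)+
  then have "\<forall>i. pd i F \<in> ?K (int e)" by blast
  moreover have "codim_ge ?K (int e * int e)"
    by (rule codim_ge_two_forms[OF nzF nz0 nzF nz0])
  ultimately show ?thesis unfolding sing_bound_def using K by auto
qed

section \<open>Syzygies of the Jacobian minors\<close>

lemma gcd_eq_1_nonzero:
  fixes m1 m2 m3 :: poly3
  assumes "gcd m1 (gcd m2 m3) = 1"
  shows "m1 \<noteq> 0 \<or> m2 \<noteq> 0 \<or> m3 \<noteq> 0"
proof (rule ccontr)
  assume "\<not> ?thesis"
  then show False using assms by simp
qed

text \<open>Each nonzero \<open>m\<^sub>i\<close> divides \<open>b\<^sub>i\<close> times all three \<open>m\<^sub>j\<close>, hence divides \<open>b\<^sub>i\<close>.\<close>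

lemma proportional_to_primitive:
  fixes m1 m2 m3 :: poly3
  assumes g: "gcd m1 (gcd m2 m3) = 1"
    and eq: "b1 * m2 = b2 * m1" "b2 * m3 = b3 * m2" "b1 * m3 = b3 * m1"
  obtains c where "b1 = c * m1" "b2 = c * m2" "b3 = c * m3"
proof -
  have dv: "m dvd b" if "m dvd b * m1" "m dvd b * m2" "m dvd b * m3" for m b
  proof -
    have "m dvd gcd (b * m1) (gcd (b * m2) (b * m3))" using that by simp
    also have "gcd (b * m2) (b * m3) = normalize (b * gcd m2 m3)"
      by (simp add: gcd_mult_left normalize_mult)
    also have "gcd (b * m1) (normalize (b * gcd m2 m3)) = gcd (b * m1) (b * gcd m2 m3)"
      by (rule gcd.normalize_right_idem)
    also have "\<dots> = normalize (b * gcd m1 (gcd m2 m3))"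
      by (simp add: gcd_mult_left normalize_mult)
    finally show ?thesis by (simp add: g)
  qed
  have aux: "b' = c * m'" if "b = c * m" "b * m' = b' * m" "m \<noteq> 0" for b b' c m m' :: poly3
    using that by (metis mult.assoc mult.commute mult_right_cancel)
  consider "m1 \<noteq> 0" | "m2 \<noteq> 0" | "m3 \<noteq> 0" using gcd_eq_1_nonzero[OF g] by blast
  then show thesis
  proof cases
    case 1
    have "m1 dvd b1" by (rule dv) (use eq in auto)
    then obtain c where c: "b1 = c * m1" by (metis dvdE mult.commute)
    show thesis by (rule that[OF c aux[OF c eq(1) 1] aux[OF c eq(3) 1]])
  next
    case 2
    have "m2 dvd b2" by (rule dv) (simp_all add: eq(2) eq(1)[symmetric])
    then obtain c where c: "b2 = c * m2" by (metis dvdE mult.commute)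
    show thesis by (rule that[OF aux[OF c eq(1)[symmetric] 2] c aux[OF c eq(2) 2]])
  next
    case 3
    have "m3 dvd b3" by (rule dv) (simp_all add: eq(2)[symmetric] eq(3)[symmetric])
    then obtain c where c: "b3 = c * m3" by (metis dvdE mult.commute)
    show thesis by (rule that[OF aux[OF c eq(3)[symmetric] 3] aux[OF c eq(2)[symmetric] 3] c])
  qed
qed

text \<open>The vector \<open>m\<close> is the cross product of \<open>a\<close> and \<open>b\<close>. A vector \<open>x\<close> orthogonal to \<open>m\<close> has cross
  products with \<open>a\<close> and with \<open>b\<close> that are parallel to \<open>m\<close>, and as \<open>m\<close> is primitive they are multiples
  of it. The two factors are the coefficients of the combination, up to sign.\<close>

lemma syzygy_of_minors:
  fixes a1 a2 a3 b1 b2 b3 x1 x2 x3 :: poly3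
  defines "m1 \<equiv> a2 * b3 - a3 * b2" and "m2 \<equiv> a3 * b1 - a1 * b3" and "m3 \<equiv> a1 * b2 - a2 * b1"
  assumes g: "gcd m1 (gcd m2 m3) = 1" and x: "x1 * m1 + x2 * m2 + x3 * m3 = 0"
  obtains u w where "x1 = u * a1 + w * b1" "x2 = u * a2 + w * b2" "x3 = u * a3 + w * b3"
proof -
  have par: "\<exists>c. x2 * a3 - x3 * a2 = c * m1 \<and> x3 * a1 - x1 * a3 = c * m2 \<and> x1 * a2 - x2 * a1 = c * m3"
    if "a1 * m1 + a2 * m2 + a3 * m3 = 0" "x1 * m1 + x2 * m2 + x3 * m3 = 0" for a1 a2 a3 x1 x2 x3
  proof -
    have "(x2 * a3 - x3 * a2) * m2 - (x3 * a1 - x1 * a3) * m1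
        = a3 * (x1 * m1 + x2 * m2 + x3 * m3) - x3 * (a1 * m1 + a2 * m2 + a3 * m3)"
      "(x3 * a1 - x1 * a3) * m3 - (x1 * a2 - x2 * a1) * m2
        = a1 * (x1 * m1 + x2 * m2 + x3 * m3) - x1 * (a1 * m1 + a2 * m2 + a3 * m3)"
      "(x2 * a3 - x3 * a2) * m3 - (x1 * a2 - x2 * a1) * m1
        = x2 * (a1 * m1 + a2 * m2 + a3 * m3) - a2 * (x1 * m1 + x2 * m2 + x3 * m3)"
      by algebra+
    then have eq: "(x2 * a3 - x3 * a2) * m2 = (x3 * a1 - x1 * a3) * m1"
      "(x3 * a1 - x1 * a3) * m3 = (x1 * a2 - x2 * a1) * m2"
      "(x2 * a3 - x3 * a2) * m3 = (x1 * a2 - x2 * a1) * m1"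
      by (simp_all add: that)
    show ?thesis by (rule proportional_to_primitive[OF g eq]) blast
  qed
  have am: "a1 * m1 + a2 * m2 + a3 * m3 = 0" and bm: "b1 * m1 + b2 * m2 + b3 * m3 = 0"
    unfolding m1_def m2_def m3_def by algebra+
  obtain c where c: "x2 * a3 - x3 * a2 = c * m1" "x3 * a1 - x1 * a3 = c * m2" "x1 * a2 - x2 * a1 = c * m3"
    using par[OF am x] by blast
  obtain d where d: "x2 * b3 - x3 * b2 = d * m1" "x3 * b1 - x1 * b3 = d * m2" "x1 * b2 - x2 * b1 = d * m3"
    using par[OF bm x] by blast
  \<comment> \<open>The vector \<open>y\<close> is parallel to both \<open>a\<close> and \<open>b\<close>, which are not parallel to each other.\<close>
  define y1 where "y1 = x1 - d * a1 + c * b1"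
  define y2 where "y2 = x2 - d * a2 + c * b2"
  define y3 where "y3 = x3 - d * a3 + c * b3"
  have ya: "y2 * a3 = y3 * a2" "y3 * a1 = y1 * a3" "y1 * a2 = y2 * a1"
    using c unfolding y1_def y2_def y3_def m1_def m2_def m3_def by algebra+
  have yb: "y2 * b3 = y3 * b2" "y3 * b1 = y1 * b3" "y1 * b2 = y2 * b1"
    using d unfolding y1_def y2_def y3_def m1_def m2_def m3_def by algebra+
  have "y1 * m1 = 0 \<and> y1 * m2 = 0 \<and> y1 * m3 = 0" "y2 * m1 = 0 \<and> y2 * m2 = 0 \<and> y2 * m3 = 0"
    "y3 * m1 = 0 \<and> y3 * m2 = 0 \<and> y3 * m3 = 0"
    using ya yb unfolding m1_def m2_def m3_def by (intro conjI; algebra)+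
  moreover have "m1 \<noteq> 0 \<or> m2 \<noteq> 0 \<or> m3 \<noteq> 0" by (rule gcd_eq_1_nonzero[OF g])
  ultimately have "y1 = 0" "y2 = 0" "y3 = 0" by auto
  then show thesis using that[of d "- c"] unfolding y1_def y2_def y3_def by (simp add: algebra_simps)
qed

interpretation S32: vector_space_prod scale scale ..
interpretation S333: vector_space_prod scale S32.scale ..
interpretation S2to3: vector_space_pair S32.scale S333.scale ..
interpretation S3to1: vector_space_pair S333.scale scale ..

definition minor :: "poly3 \<Rightarrow> poly3 \<Rightarrow> 3 \<Rightarrow> 3 \<Rightarrow> poly3" where
  "minor f g i j = pd i f * pd j g - pd j f * pd i g"

lemma minor_swap: "minor f g j i = - minor f g i j"
  by (simp add: minor_def algebra_simps)

lemma forms_minor: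
  assumes "f \<in> forms (e + 1)" "g \<in> forms (e + 1)" shows "minor f g i j \<in> forms (2 * e)"
  unfolding minor_def using assms[THEN forms_pd]
  by (auto intro!: forms_diff dest: forms_mult)
    (metis add_diff_cancel_right' forms_mult mult_2)+

text \<open>The multiples of the minors in degree \<open>n\<close> are the image of the triples of forms of degree
  \<open>n - 2 * e\<close>, with the syzygies as kernel, and these are given by pairs of forms of degree
  \<open>n - 3 * e\<close>. The dimension of the cokernel is \<open>3 * e\<^sup>2\<close>, the number of critical points of a
  general pencil.\<close>

lemma codim_minors_le:
  assumes f: "f \<in> forms (int e + 1)" and g: "g \<in> forms (int e + 1)"
    and gcd1: "gcd (minor f g 2 3) (gcd (minor f g 3 1) (minor f g 1 2)) = 1"
    and K: "graded_ideal K" "\<And>i j. minor f g i j \<in> K (2 * int e)" and n: "n \<ge> 3 * int e"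
  shows "int (S3.dim (forms n)) \<le> int (S3.dim (K n)) + 3 * (int e * int e)"
proof -
  define a where "a = n - 2 * int e"
  let ?m1 = "minor f g 2 3" and ?m2 = "minor f g 3 1" and ?m3 = "minor f g 1 2"
  let ?T = "\<lambda>z. fst z * ?m1 + (fst (snd z) * ?m2 + snd (snd z) * ?m3)"
  let ?P = "\<lambda>z. (fst z * pd 1 f + snd z * pd 1 g, (fst z * pd 2 f + snd z * pd 2 g, fst z * pd 3 f + snd z * pd 3 g))"
  let ?A = "forms a \<times> (forms a \<times> forms a)"
  let ?B = "forms (a - int e) \<times> forms (a - int e)"
  have linT: "Vector_Spaces.linear S333.scale scale ?T"
    by unfold_locales (simp_all add: S333.scale_def S32.scale_def scale_conv algebra_simps)
  have linP: "Vector_Spaces.linear S32.scale S333.scale ?P"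
    by unfold_locales (simp_all add: S333.scale_def S32.scale_def scale_conv algebra_simps)
  note sub = forms_subspace finite_span_forms
  have A2: "S32.p.subspace (forms a \<times> forms a)" "S32.p.finite_span (forms a \<times> forms a)"
    by (intro S32.subspace_Times S32.finite_span_Times sub)+
  have A: "S333.p.subspace ?A" "S333.p.finite_span ?A"
    by (intro S333.subspace_Times S333.finite_span_Times sub A2)+
  have B: "S32.p.subspace ?B" "S32.p.finite_span ?B"
    by (intro S32.subspace_Times S32.finite_span_Times sub)+
  have dimA: "S333.p.dim ?A = 3 * S3.dim (forms a)"
    using S333.dim_Times[OF sub A2] S32.dim_Times[OF sub sub] by simp
  have dimB: "S32.p.dim ?B = 2 * S3.dim (forms (a - int e))"
    using S32.dim_Times[OF sub sub] by simp
  have pf: "pd i f \<in> forms (int e)" and pg: "pd i g \<in> forms (int e)" for i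
    using forms_pd[OF f, of i] forms_pd[OF g, of i] by auto
  have PB: "?P ` ?B \<subseteq> ?A"
  proof -
    have "u * pd i f + w * pd i g \<in> forms a"
      if "u \<in> forms (a - int e)" "w \<in> forms (a - int e)" for u w i
      using forms_add[OF forms_mult[OF that(1) pf] forms_mult[OF that(2) pg]] by simp
    then show ?thesis by auto
  qed
  have "{z \<in> ?A. ?T z = 0} \<subseteq> ?P ` ?B"
  proof
    fix z assume "z \<in> {z \<in> ?A. ?T z = 0}"
    then obtain x1 x2 x3 where x: "z = (x1, (x2, x3))" "x1 \<in> forms a" "x2 \<in> forms a" "x3 \<in> forms a"
      "x1 * ?m1 + x2 * ?m2 + x3 * ?m3 = 0" by (cases z) (auto simp: add.assoc)
    obtain u w where uw: "x1 = u * pd 1 f + w * pd 1 g" "x2 = u * pd 2 f + w * pd 2 g" "x3 = u * pd 3 f + w * pd 3 g"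
      by (rule syzygy_of_minors[OF gcd1[unfolded minor_def] x(5)[unfolded minor_def]])
    define X where "X i = u * pd i f + w * pd i g" for i
    have X: "X i \<in> forms a" for i using exhaust_3[of i] x(2-4) uw by (auto simp: X_def)
    \<comment> \<open>Cramer's rule shows that the coefficients of the combination are forms of the right degree.\<close>
    obtain i j where ij: "minor f g i j \<noteq> 0" using gcd_eq_1_nonzero[OF gcd1] by blast
    have "X i * pd j g - X j * pd i g = minor f g i j * u" "pd i f * X j - pd j f * X i = minor f g i j * w"
      by (simp_all add: X_def minor_def algebra_simps)
    moreover have "X i * pd j g - X j * pd i g \<in> forms (a + int e)" "pd i f * X j - pd j f * X i \<in> forms (a + int e)"
      using forms_diff[OF forms_mult[OF X[of i] pg[of j]] forms_mult[OF X[of j] pg[of i]]]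
        forms_diff[OF forms_mult[OF pf[of i] X[of j]] forms_mult[OF pf[of j] X[of i]]]
      by (simp_all add: add.commute)
    ultimately have "u \<in> forms (a - int e)" "w \<in> forms (a - int e)"
      using forms_divide[OF ij forms_minor[OF f g], of _ "a + int e"] by (simp_all add: algebra_simps)
    then show "z \<in> ?P ` ?B" using x(1) uw by (intro image_eqI[of _ _ "(u, w)"]) auto
  qed
  then have "S333.p.dim {z \<in> ?A. ?T z = 0} \<le> S333.p.dim (?P ` ?B)"
    by (intro S333.p.dim_mono_finite_span S333.p.finite_span_subset[OF A(2) PB])
  also have "\<dots> \<le> 2 * S3.dim (forms (a - int e))"
    using S2to3.rank_nullity[OF linP B] dimB by linarith
  finally have "3 * S3.dim (forms a) \<le> S3.dim (?T ` ?A) + 2 * S3.dim (forms (a - int e))"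
    using S3to1.rank_nullity[OF linT A] dimA by linarith
  moreover have "S3.dim (?T ` ?A) \<le> S3.dim (K n)"
  proof (intro S3.dim_mono_finite_span graded_idealD[OF K(1)])
    have "x * minor f g i j \<in> K n" if "x \<in> forms a" for x i j
      using graded_idealD(4)[OF K(1) K(2) that] by (simp add: a_def)
    then show "?T ` ?A \<subseteq> K n"
      by (auto intro!: S3.subspace_add[OF graded_idealD(2)[OF K(1)]])
  qed
  ultimately have "3 * (2 * int (S3.dim (forms a))) \<le> 2 * int (S3.dim (K n)) + 2 * (2 * int (S3.dim (forms (a - int e))))"
    by linarith
  moreover have "2 * int (S3.dim (forms a)) = (a + 1) * (a + 2)"
    "2 * int (S3.dim (forms (a - int e))) = (a - int e + 1) * (a - int e + 2)"
    "2 * int (S3.dim (forms n)) = (n + 1) * (n + 2)"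
    using n by (intro dim_forms; simp add: a_def)+
  moreover have "3 * ((a + 1) * (a + 2)) = 2 * ((a - int e + 1) * (a - int e + 2)) + (n + 1) * (n + 2) - 6 * (int e * int e)"
    by (simp add: a_def algebra_simps)
  ultimately show ?thesis by linarith
qed

section \<open>The minors have no common factor\<close>

lemma unit_form_degree:
  assumes "F \<in> forms k" "is_unit F" shows "k = 0"
proof -
  obtain u where u: "F * u = 1" using assms(2) by (metis dvdE)
  then have nz: "F \<noteq> 0" "u \<noteq> 0" by auto
  have "u \<in> forms (0 - k)" using forms_divide[OF nz(1) assms(1), of u 0] u forms_1 by simp
  then have "\<not> 0 - k < 0" using nz(2) forms_neg[of "0 - k"] by auto
  moreover have "\<not> k < 0" using nz(1) assms(1) forms_neg[of k] by auto
  ultimately show ?thesis by simp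
qed

lemma const3_unit: "c \<noteq> 0 \<Longrightarrow> is_unit (const3 c)"
proof -
  assume "c \<noteq> 0"
  then have "const3 c * const3 (inverse c) = 1" by (simp flip: const3_simps(4))
  then show ?thesis by (metis dvd_triv_left)
qed

lemma prime_form_degree_pos:
  assumes "prime_elem h" "h \<in> forms k" shows "k > 0"
proof (rule ccontr)
  assume "\<not> k > 0"
  moreover have "h \<noteq> 0" "\<not> is_unit h" using assms(1) by (auto simp: prime_elem_def)
  moreover have "k \<noteq> 0"
  proof
    assume "k = 0"
    then obtain c where "h = const3 c" using forms_zeroD assms(2) by metis
    then show False using const3_unit[of c] \<open>h \<noteq> 0\<close> \<open>\<not> is_unit h\<close> by auto
  qed
  ultimately show False using forms_neg[of k] assms(2) by auto
qed

lemma poly3_dvd_linear_factor: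
  fixes h s t :: poly3
  assumes "prime_elem h" "\<And>\<gamma>. \<not> h dvd s - const3 \<gamma> * t" "\<not> h dvd t"
    and "h dvd (\<Sum>k\<le>m. scale (c k) (s ^ k * t ^ (m - k)))" "i \<le> m"
  shows "c i = 0"
proof (rule ccontr)
  assume ci: "c i \<noteq> 0"
  define a where "a = (\<Sum>k\<le>m. monom (c k) k)"
  have coeff_a: "coeff a k = (if k \<le> m then c k else 0)" for k
    by (simp add: a_def coeff_sum)
  have "1 \<in> {q. h dvd q}"
  proof (rule binary_form_cancel[where s = s and t = t and a = a and m = m])
    show "a \<noteq> 0" using coeff_a[of i] ci assms(5) by auto
    show "degree a \<le> m" by (rule degree_le) (simp add: coeff_a)
    show "(\<Sum>k\<le>m. const3 (coeff a k) * s ^ k * t ^ (m - k)) * 1 \<in> {q. h dvd q}"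
      using assms(4) by (simp add: coeff_a scale_conv mult.assoc)
    show "q \<in> {q. h dvd q}" if "c \<noteq> 0" "const3 c * q \<in> {q. h dvd q}" for c q
      using that const3_unit[of c] dvd_mult_unit_iff'[of "const3 c" h q] by simp
  qed (use assms(1-3) in \<open>auto simp: prime_elem_dvd_mult_iff\<close>)
  then show False using assms(1) by (auto simp: prime_elem_def)
qed

text \<open>A derivation along the curve \<open>h = 0\<close>, in terms of two of the three variables.\<close>

definition tangent :: "poly3 \<Rightarrow> 3 \<Rightarrow> 3 \<Rightarrow> poly3 \<Rightarrow> poly3" where
  "tangent h b c F = pd c h * pd b F - pd b h * pd c F"

lemma tangent_mult: "tangent h b c (F * G) = tangent h b c F * G + F * tangent h b c G"
  by (simp add: tangent_def pd_mult algebra_simps)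

lemma tangent_add [simp]: "tangent h b c (F + G) = tangent h b c F + tangent h b c G"
  by (simp add: tangent_def algebra_simps)

lemma tangent_0 [simp]: "tangent h b c 0 = 0"
  by (simp add: tangent_def)

lemma tangent_1 [simp]: "tangent h b c 1 = 0"
  by (simp add: tangent_def)

lemma tangent_scale [simp]: "tangent h b c (scale k F) = scale k (tangent h b c F)"
  by (simp add: tangent_def scale_conv pd_mult algebra_simps)

lemma tangent_sum: "tangent h b c (sum F A) = (\<Sum>x\<in>A. tangent h b c (F x))"
  by (induction A rule: infinite_finite_induct) simp_all

lemma tangent_power: "tangent h b c (F ^ n) = of_nat n * F ^ (n - 1) * tangent h b c F"
  by (simp add: tangent_def pd_power algebra_simps)

lemma dvd_tangent: "h dvd F \<Longrightarrow> h dvd tangent h b c F"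
proof -
  have "tangent h b c h = 0" by (simp add: tangent_def)
  then show "h dvd F \<Longrightarrow> h dvd tangent h b c F" by (auto simp: tangent_mult elim!: dvdE)
qed

context
  fixes h g :: poly3 and a b c :: 3
  assumes h: "prime_elem h" and hg: "\<not> h dvd g" and hx: "\<not> h dvd var a" and hc: "\<not> h dvd pd c h"
    and abc: "a \<noteq> b" "a \<noteq> c" "b \<noteq> c"
begin

abbreviation der where "der \<equiv> tangent h b c"

text \<open>The polynomials \<open>F\<close> for which \<open>F / g ^ N\<close> has derivative zero along the curve.\<close>

definition flat :: "nat \<Rightarrow> poly3 set" where
  "flat N = {F. h dvd g * der F - of_nat N * der g * F}"

lemma flat_subspace: "S3.subspace (flat N)"
  unfolding S3.subspace_def
proof (intro conjI ballI allI)
  show "F + G \<in> flat N" if "F \<in> flat N" "G \<in> flat N" for F G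
  proof -
    have "g * der (F + G) - of_nat N * der g * (F + G)
        = (g * der F - of_nat N * der g * F) + (g * der G - of_nat N * der g * G)"
      by (simp add: algebra_simps)
    then show ?thesis using that unfolding flat_def by simp
  qed
  show "scale k F \<in> flat N" if "F \<in> flat N" for k F
  proof -
    have "g * der (scale k F) - of_nat N * der g * scale k F
        = const3 k * (g * der F - of_nat N * der g * F)"
      by (simp only: tangent_scale) (simp add: scale_conv algebra_simps)
    then show ?thesis using that unfolding flat_def by simp
  qed
qed (simp add: flat_def)

lemma flat_powers:
  assumes "h dvd g * der f - der g * f"
  shows "f ^ i * g ^ j \<in> flat (i + j)"
proof -
  have f: "f * F \<in> flat (Suc N)" if "F \<in> flat N" for F N
  proof -
    have "g * der (f * F) - of_nat (Suc N) * der g * (f * F)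
        = F * (g * der f - der g * f) + f * (g * der F - of_nat N * der g * F)"
      by (simp add: tangent_mult algebra_simps)
    then show ?thesis using that assms unfolding flat_def by simp
  qed
  have g: "g * F \<in> flat (Suc N)" if "F \<in> flat N" for F N
  proof -
    have "g * der (g * F) - of_nat (Suc N) * der g * (g * F) = g * (g * der F - of_nat N * der g * F)"
      by (simp add: tangent_mult algebra_simps)
    then show ?thesis using that unfolding flat_def by simp
  qed
  have "g ^ j \<in> flat j" by (induction j) (use g in \<open>auto simp: flat_def\<close>)
  then show ?thesis by (induction i) (use f in \<open>auto simp: mult.assoc\<close>)
qed

text \<open>Differentiating a relation along the curve lowers its degree in \<open>var b\<close>, because the
  coefficients behave like constants.\<close>

lemma flat_independent:
  assumes "\<And>j. j \<le> r \<Longrightarrow> F j \<in> flat N"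
    and "h dvd (\<Sum>j\<le>r. F j * (var a ^ (r - j) * var b ^ j))" "j \<le> r"
  shows "h dvd F j"
  using assms
proof (induction r arbitrary: F j)
  case (Suc r F j)
  let ?x = "var a" and ?y = "var b"
  let ?t = "\<lambda>j. ?x ^ (Suc r - j) * ?y ^ j"
  let ?S = "\<Sum>j\<le>Suc r. F j * ?t j"
  let ?u = "\<lambda>j. of_nat j * F j * (?x ^ (Suc r - j) * ?y ^ (j - 1))"
  have Dx: "der ?x = 0" and Dy: "der ?y = pd c h"
    using abc by (auto simp: tangent_def pd_var)
  have Dt: "der (?t j) = of_nat j * (?x ^ (Suc r - j) * ?y ^ (j - 1)) * pd c h" for j
    by (simp add: tangent_mult tangent_power Dx Dy algebra_simps)
  have "g * pd c h * (\<Sum>j\<le>Suc r. ?u j)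
      = g * der ?S - of_nat N * der g * ?S - (\<Sum>j\<le>Suc r. (g * der (F j) - of_nat N * der g * F j) * ?t j)"
    unfolding tangent_sum tangent_mult[of h b c "F _"] Dt sum_distrib_left sum_subtractf[symmetric]
    by (rule sum.cong) (simp_all only: algebra_simps)
  moreover have "h dvd (\<Sum>j\<le>Suc r. (g * der (F j) - of_nat N * der g * F j) * ?t j)"
    using Suc.prems(1) by (intro dvd_sum dvd_mult2) (auto simp: flat_def)
  moreover have "h dvd g * der ?S" "h dvd of_nat N * der g * ?S"
    using Suc.prems(2) by (auto intro: dvd_tangent dvd_mult simp del: sum.atMost_Suc)
  ultimately have "h dvd g * pd c h * (\<Sum>j\<le>Suc r. ?u j)" by (simp only: dvd_diff)
  then have "h dvd (\<Sum>j\<le>Suc r. ?u j)"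
    using h hg hc by (simp only: prime_elem_dvd_mult_iff) blast
  also have "(\<Sum>j\<le>Suc r. ?u j) = (\<Sum>j\<le>r. (of_nat (Suc j) * F (Suc j)) * (?x ^ (r - j) * ?y ^ j))"
    by (subst sum.atMost_Suc_shift) simp
  finally have "h dvd (\<Sum>j\<le>r. (of_nat (Suc j) * F (Suc j)) * (?x ^ (r - j) * ?y ^ j))" .
  moreover have "of_nat (Suc j) * F (Suc j) \<in> flat N" if "j \<le> r" for j
    using S3.subspace_scale[OF flat_subspace Suc.prems(1)[of "Suc j"], of "of_nat (Suc j)"] that
    by (simp add: scale_conv del: of_nat_Suc)
  ultimately have *: "h dvd of_nat (Suc j) * F (Suc j)" if "j \<le> r" for j
    using Suc.IH[of "\<lambda>j. of_nat (Suc j) * F (Suc j)" j] that by blast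
  have pos: "h dvd F (Suc j)" if "j \<le> r" for j
    using *[OF that] dvd_mult_unit_iff'[OF const3_unit, of "of_nat (Suc j)"]
    by (simp del: of_nat_Suc)
  have "?S = F 0 * ?x ^ Suc r + (\<Sum>j\<le>r. F (Suc j) * ?t (Suc j))"
    by (subst sum.atMost_Suc_shift) simp
  then have "F 0 * ?x ^ Suc r = ?S - (\<Sum>j\<le>r. F (Suc j) * ?t (Suc j))" by simp
  also have "h dvd \<dots>"
    by (rule dvd_diff[OF Suc.prems(2)]) (auto intro!: dvd_sum dvd_mult2 pos)
  finally have "h dvd F 0"
    using h hx prime_elem_dvd_power[OF h, of "var a" "Suc r"] prime_elem_dvd_mult_iff[OF h] by blast
  moreover have "h dvd F j" if "j \<noteq> 0"
    using pos[of "j - 1"] Suc.prems(3) that by simp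
  ultimately show ?case by (cases "j = 0") simp_all
qed simp

end

lemma minor_euler:
  assumes "f \<in> forms d" "g \<in> forms d"
  shows "of_int d * (g * pd i f - f * pd i g) = (\<Sum>j\<in>UNIV. var j * minor f g i j)"
proof -
  have "(\<Sum>j\<in>UNIV. var j * minor f g i j) = euler g * pd i f - euler f * pd i g"
    by (simp add: minor_def euler_def sum_distrib_right right_diff_distrib sum_subtractf mult.assoc
        mult.commute[of "pd i f"])
  then show ?thesis using assms by (simp add: forms_def algebra_simps)
qed

text \<open>If the minors vanish on the curve \<open>h = 0\<close>, the derivative of \<open>f / g\<close> along it is zero, so
  \<open>f / g\<close> must be constant on it. Otherwise, for suitable variables \<open>x\<close> and \<open>y\<close>, all
  products \<open>f ^ i * g ^ (N - i) * x ^ (N - j) * y ^ j\<close> would be independent modulo \<open>h\<close>, but there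
  are too many of them.\<close>

lemma curve_in_member:
  assumes f: "f \<in> forms (int d)" and g: "g \<in> forms (int d)" and d: "d > 0"
    and h: "prime_elem h" "h \<in> forms (int k)" and dv: "\<And>i j. h dvd minor f g i j"
  obtains a b where "(a, b) \<noteq> (0, 0)" "h dvd scale a f + scale b g"
proof -
  have False if no: "\<And>a b. (a, b) \<noteq> (0, 0) \<Longrightarrow> \<not> h dvd scale a f + scale b g"
  proof -
    have h0: "h \<noteq> 0" using h(1) by (auto simp: prime_elem_def)
    have k: "k > 0" using prime_form_degree_pos[OF h] by simp
    have small: "F = 0" if dF: "h dvd F" "F \<in> forms n" "n < int k" for F n
    proof -
      obtain q where "F = h * q" using dF by (elim dvdE)
      then have "q \<in> forms (n - int k)" using forms_divide[OF h0 h(2)] that(2) by simp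
      then show ?thesis using forms_neg[of "n - int k"] that(3) \<open>F = h * q\<close> by simp
    qed
    have "\<exists>c. pd c h \<noteq> 0"
    proof (rule ccontr)
      assume "\<nexists>c. pd c h \<noteq> 0"
      then have "euler h = 0" by (simp add: euler_def)
      then show False using h(2) h0 k by (simp add: forms_def)
    qed
    then obtain c where c: "pd c h \<noteq> 0" by blast
    define a :: 3 where "a = (if c = 1 then 2 else 1)"
    define b :: 3 where "b = (if c = 3 then 2 else 3)"
    have abc: "a \<noteq> b" "a \<noteq> c" "b \<noteq> c"
      using exhaust_3[of c] by (auto simp: a_def b_def)
    have hc: "\<not> h dvd pd c h" using small[OF _ forms_pd[OF h(2), of c]] c by auto
    have hx: "\<not> h dvd var a"
    proof
      assume "h dvd var a"
      then obtain q where q: "var a = h * q" by (elim dvdE)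
      have "pd c (var a) = 0" using abc by (simp add: pd_var)
      then have "q * pd c h = h * - pd c q" unfolding q by (simp add: pd_mult algebra_simps eq_neg_iff_add_eq_0)
      then have "h dvd q" using prime_elem_dvd_mult_iff[OF h(1)] hc by (metis dvd_triv_left)
      moreover have "q \<in> forms (1 - int k)" using forms_divide[OF h0 h(2), of q 1] forms_var[of a] q by simp
      ultimately have "q = 0" using small k by simp
      then have "pd a (var a) = pd a 0" using q by simp
      then show False by (simp add: pd_var)
    qed
    have hg: "\<not> h dvd g" using no[of 0 1] by simp
    have flat1: "h dvd g * tangent h b c f - tangent h b c g * f"
    proof -
      have dg: "h dvd g * pd i f - f * pd i g" for i
      proof -
        have "h dvd of_int (int d) * (g * pd i f - f * pd i g)"
          unfolding minor_euler[OF f g] using dv by (intro dvd_sum dvd_mult)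
        then show ?thesis
          using dvd_mult_unit_iff'[OF const3_unit, of "of_nat d"] d by simp
      qed
      have "g * tangent h b c f - tangent h b c g * f
          = pd c h * (g * pd b f - f * pd b g) - pd b h * (g * pd c f - f * pd c g)"
        by (simp add: tangent_def algebra_simps)
      then show ?thesis using dg by simp
    qed
    \<comment> \<open>There are \<open>(N + 1)\<^sup>2\<close> products, but only about \<open>k * n = N\<^sup>2\<close> dimensions modulo \<open>h\<close>.\<close>
    define N where "N = k * (d + 1)"
    define n where "n = int (N * (d + 1))"
    let ?w = "\<lambda>z. f ^ fst z * g ^ (N - fst z) * (var a ^ (N - snd z) * var b ^ snd z)"
    let ?H = "ideal_mult (int k) h forms"
    have H: "graded_ideal ?H" by (rule graded_ideal_mult[OF graded_ideal_forms h(2)])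
    have "card ({..N} \<times> {..N}) + S3.dim (?H n) \<le> S3.dim (forms n)"
    proof (rule S3.card_add_dim_le[where w = ?w, OF forms_subspace finite_span_forms graded_idealD(2,1)[OF H]])
      fix z assume z: "z \<in> {..N} \<times> {..N}"
      have "?w z \<in> forms ((int (fst z) * int d + int (N - fst z) * int d) + (int (N - snd z) * 1 + int (snd z) * 1))"
        by (intro forms_mult forms_power f g forms_var)
      also have "(int (fst z) * int d + int (N - fst z) * int d) + (int (N - snd z) * 1 + int (snd z) * 1) = n"
        using z by (auto simp: n_def of_nat_diff algebra_simps)
      finally show "?w z \<in> forms n" .
    next
      fix cf z assume s: "(\<Sum>z\<in>{..N} \<times> {..N}. scale (cf z) (?w z)) \<in> ?H n" and z: "z \<in> {..N} \<times> {..N}"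
      let ?F = "\<lambda>j. \<Sum>i\<le>N. scale (cf (i, j)) (f ^ i * g ^ (N - i))"
      have "(\<Sum>z\<in>{..N} \<times> {..N}. scale (cf z) (?w z)) = (\<Sum>i\<le>N. \<Sum>j\<le>N. scale (cf (i, j)) (?w (i, j)))"
        by (simp add: sum.cartesian_product case_prod_beta)
      also have "\<dots> = (\<Sum>j\<le>N. ?F j * (var a ^ (N - j) * var b ^ j))"
        by (subst sum.swap) (simp add: sum_distrib_right scale_conv mult.assoc)
      finally have "h dvd (\<Sum>j\<le>N. ?F j * (var a ^ (N - j) * var b ^ j))"
        using s by (auto simp: ideal_mult_def)
      moreover have "?F j \<in> flat h g b c N" for j
      proof (intro S3.subspace_sum S3.subspace_scale flat_subspace[OF h(1) hg hx hc abc])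
        show "f ^ i * g ^ (N - i) \<in> flat h g b c N" if "i \<in> {..N}" for i
          using flat_powers[OF h(1) hg hx hc abc flat1, of i "N - i"] that by simp
      qed
      ultimately have "h dvd ?F j" if "j \<le> N" for j
        using flat_independent[OF h(1) hg hx hc abc, of N ?F N j] that by blast
      then have "h dvd ?F (snd z)" using z by auto
      moreover have "\<not> h dvd f - const3 \<gamma> * g" for \<gamma>
        using no[of 1 "- \<gamma>"] by (simp add: scale_conv)
      ultimately have "cf (fst z, snd z) = 0"
        using poly3_dvd_linear_factor[OF h(1), of f g "\<lambda>i. cf (i, snd z)" N "fst z"] z hg by auto
      then show "cf z = 0" by simp
    qed auto
    then have "(N + 1) * (N + 1) + S3.dim (forms (n - int k)) \<le> S3.dim (forms n)"
      unfolding dim_ideal_mult[OF graded_ideal_forms h0] by (simp add: card_cartesian_product)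
    then have "int ((N + 1) * (N + 1)) + int (S3.dim (forms (n - int k))) \<le> int (S3.dim (forms n))"
      by linarith
    then have "2 * ((int N + 1) * (int N + 1)) + 2 * int (S3.dim (forms (n - int k))) \<le> 2 * int (S3.dim (forms n))"
      by (simp add: algebra_simps)
    moreover have "n \<ge> int k" unfolding n_def N_def by (simp add: algebra_simps)
    ultimately have "2 * ((int N + 1) * (int N + 1)) + (n - int k + 1) * (n - int k + 2) \<le> (n + 1) * (n + 2)"
      by (simp add: dim_forms)
    moreover have "n * int k = int N * int N" unfolding n_def N_def by (simp add: algebra_simps)
    ultimately have "4 * int N + 2 + int k * int k \<le> 3 * int k" by (simp add: algebra_simps)
    moreover have "int N \<ge> int k" unfolding N_def by (simp add: algebra_simps)
    ultimately show False using zero_le_square[of "int k"] by linarith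
  qed
  then show thesis using that by blast
qed

lemma coprime_forms_combination_nonzero:
  assumes f: "f \<in> forms (int d)" and g: "g \<in> forms (int d)" and d: "d > 0" and co: "coprime f g"
    and ab: "(a, b) \<noteq> (0, 0)"
  shows "scale a f + scale b g \<noteq> 0"
proof
  assume z: "scale a f + scale b g = 0"
  have nu: "\<not> is_unit f" "\<not> is_unit g" using unit_form_degree[OF f] unit_form_degree[OF g] d by auto
  have "g dvd f \<or> f dvd g"
  proof (cases "a = 0")
    case True
    then have "g = 0" using z ab by simp
    then show ?thesis by simp
  next
    case False
    then have "g dvd const3 a * f" using z by (metis add_eq_0_iff2 dvd_minus_iff dvd_triv_right scale_conv)
    then show ?thesis using dvd_mult_unit_iff'[OF const3_unit[OF False]] by blast
  qed
  then show False using co nu coprime_absorb_left[of f g] coprime_absorb_right[of g f] by blast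
qed

text \<open>A zero of \<open>h\<close> on a member other than the one that \<open>h\<close> divides is a base point, and the minors vanish
  there.\<close>

lemma transverse_no_common_prime:
  assumes f: "f \<in> forms (int d)" and g: "g \<in> forms (int d)" and d: "d > 0" and co: "coprime f g"
    and tr: "transverse_at_base_points f g"
    and h: "prime_elem h" "h \<in> forms k"
  shows "\<exists>i j. \<not> h dvd minor f g i j"
proof (rule ccontr)
  assume "\<nexists>i j. \<not> h dvd minor f g i j"
  then have dv: "h dvd minor f g i j" for i j by blast
  have k: "k > 0" using prime_form_degree_pos[OF h] .
  then obtain k' where k': "k = int k'" using zero_le_imp_eq_int[of k] by auto
  obtain a b where ab: "(a, b) \<noteq> (0, 0)" "h dvd scale a f + scale b g"
    using curve_in_member[OF f g d h(1) h(2)[unfolded k'] dv] by blast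
  have f0: "f \<noteq> 0" and g0: "g \<noteq> 0"
    using coprime_forms_combination_nonzero[OF f g d co, of 1 0]
      coprime_forms_combination_nonzero[OF f g d co, of 0 1] by auto
  have h0: "h \<noteq> 0" using h(1) by (auto simp: prime_elem_def)
  define G where "G = (if b = 0 then g else f)"
  have G: "G \<in> forms (int d)" "G \<noteq> 0" using f g f0 g0 by (auto simp: G_def)
  obtain v where v: "v \<noteq> 0" "eval3 h v = 0" "eval3 G v = 0"
    using forms_two_common_zero[OF h(2) h0 k G(1,2)] d by auto
  have ev: "h dvd F \<Longrightarrow> eval3 F v = 0" for F using v(2) by (auto elim!: dvdE)
  have "a * eval3 f v + b * eval3 g v = 0" using ev[OF ab(2)] by simp
  then have base: "is_base_point f g v" unfolding is_base_point_def
    using v(1,3) ab(1) by (auto simp: G_def split: if_splits)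
  then have li: "\<And>a b. a *s gradient f v + b *s gradient g v = 0 \<Longrightarrow> a = 0 \<and> b = 0"
    using tr unfolding transverse_at_base_points_def by blast
  have m: "eval3 (pd i f) v * eval3 (pd j g) v = eval3 (pd j f) v * eval3 (pd i g) v" for i j
    using ev[OF dv[of i j]] by (simp add: minor_def)
  have "gradient f v \<noteq> 0" using li[of 1 0] by auto
  then obtain i where i: "eval3 (pd i f) v \<noteq> 0" by (auto simp: vec_eq_iff gradient_nth)
  have "eval3 (pd i g) v *s gradient f v + (- eval3 (pd i f) v) *s gradient g v = 0"
    using m[of i] by (simp add: vec_eq_iff gradient_nth mult.commute)
  then show False using li i by fastforce
qed

lemma transverse_minors_gcd:
  assumes f: "f \<in> forms (int e + 1)" and g: "g \<in> forms (int e + 1)" and co: "coprime f g"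
    and tr: "transverse_at_base_points f g"
  shows "gcd (minor f g 2 3) (gcd (minor f g 3 1) (minor f g 1 2)) = 1" (is "?G = 1")
proof -
  let ?d = "Suc e"
  have f': "f \<in> forms (int ?d)" and g': "g \<in> forms (int ?d)" using f g by (auto simp: add.commute)
  note no = transverse_no_common_prime[OF f' g' _ co tr]
  have all: "h dvd minor f g i j" if "h dvd minor f g 2 3" "h dvd minor f g 3 1" "h dvd minor f g 1 2" for h i j
  proof -
    have "minor f g i i = 0" for i by (simp add: minor_def)
    then show ?thesis using exhaust_3[of i] exhaust_3[of j] that
      minor_swap[of f g 3 2] minor_swap[of f g 1 3] minor_swap[of f g 2 1] by auto
  qed
  have "is_unit ?G"
  proof (rule ccontr)
    assume nu: "\<not> is_unit ?G"
    show False
    proof (cases "?G = 0")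
      case True
      \<comment> \<open>If all minors vanish, every prime form divides them, for example a factor of \<open>f\<close>.\<close>
      have "f \<noteq> 0" using coprime_forms_combination_nonzero[OF f' g' _ co, of 1 0] by auto
      moreover have "\<not> is_unit f" using unit_form_degree[OF f'] by auto
      ultimately obtain h where h: "h dvd f" "prime h" using prime_divisor_exists by blast
      then obtain k where k: "h \<in> forms k" using prime_dvd_form[OF _ h(1) f'] \<open>f \<noteq> 0\<close> by auto
      have z: "minor f g 2 3 = 0" "minor f g 3 1 = 0" "minor f g 1 2 = 0"
        using True by (simp_all only: gcd_eq_0_iff)
      have "h dvd minor f g i j" for i j
        by (rule all[of h i j, unfolded z, OF dvd_0_right dvd_0_right dvd_0_right])
      then show False using no[of h k] h(2) k by auto
    next
      case False
      then obtain h where h: "h dvd ?G" "prime h" using nu prime_divisor_exists by blast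
      have "h dvd minor f g 2 3 \<and> h dvd minor f g 3 1 \<and> h dvd minor f g 1 2"
        using h(1) by (simp only: gcd_greatest_iff)
      then have hm: "h dvd minor f g i j" for i j using all by blast
      have "minor f g 2 3 \<noteq> 0 \<or> minor f g 3 1 \<noteq> 0 \<or> minor f g 1 2 \<noteq> 0"
        using False by (simp only: gcd_eq_0_iff de_Morgan_conj)
      then obtain i j where "minor f g i j \<noteq> 0" by blast
      then obtain k where "h \<in> forms k"
        using prime_dvd_form[OF _ hm forms_minor[OF f g]] h(2) by blast
      then show False using no[of h] h(2) hm by auto
    qed
  qed
  then have "normalize ?G = 1" by (rule is_unit_normalize)
  then show ?thesis by (simp only: normalize_gcd)
qed

section \<open>Adding up the members\<close>

definition joint_ideal :: "'a set \<Rightarrow> ('a \<Rightarrow> int \<Rightarrow> poly3 set) \<Rightarrow> int \<Rightarrow> poly3 set" where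
  "joint_ideal X K n = {p \<in> forms n. \<forall>x\<in>X. p \<in> K x n}"

lemma graded_ideal_joint:
  assumes "\<And>x. x \<in> X \<Longrightarrow> graded_ideal (K x)"
  shows "graded_ideal (joint_ideal X K)"
  using assms forms_subspace[THEN S3.subspace_0] unfolding graded_ideal_def joint_ideal_def
  by (auto simp: S3.subspace_def forms_add forms_scale add.commute mult.commute[of _ "_ :: poly3"] dest: forms_mult)

lemma joint_ideal_insert: "joint_ideal (insert x X) K n = K x n \<inter> joint_ideal X K n"
  by (auto simp: joint_ideal_def)

text \<open>If each \<open>K x\<close> had an element that does not vanish at \<open>v\<close>, their product would be in all \<open>K x\<close>.\<close>

lemma joint_ideal_common_zero:
  assumes "finite X" "\<And>x. x \<in> X \<Longrightarrow> graded_ideal (K x)"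
    and "\<And>n p. p \<in> joint_ideal X K n \<Longrightarrow> eval3 p v = 0"
  obtains x where "x \<in> X" "\<And>n p. p \<in> K x n \<Longrightarrow> eval3 p v = 0"
proof -
  have False if no: "\<And>x. x \<in> X \<Longrightarrow> \<exists>n p. p \<in> K x n \<and> eval3 p v \<noteq> 0"
  proof -
    obtain N p where p: "\<And>x. x \<in> X \<Longrightarrow> p x \<in> K x (N x)" "\<And>x. x \<in> X \<Longrightarrow> eval3 (p x) v \<noteq> 0"
      using no by metis
    have pf: "p x \<in> forms (N x)" if "x \<in> X" for x
      using p(1)[OF that] graded_idealD(1)[OF assms(2)[OF that]] by blast
    have forms: "prod p Y \<in> forms (sum N Y)" if "Y \<subseteq> X" for Y
    proof -
      have "finite Y" using that assms(1) by (rule finite_subset)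
      then show ?thesis using that
        by (induction Y rule: finite_induct) (auto simp: forms_1 intro!: forms_mult pf)
    qed
    have "prod p X \<in> K x (sum N X)" if "x \<in> X" for x
      using graded_idealD(4)[OF assms(2)[OF that] p(1)[OF that] forms[of "X - {x}"]] that assms(1)
      by (simp add: prod.remove[of X x p] sum.remove[of X x N] mult.commute)
    then have "prod p X \<in> joint_ideal X K (sum N X)" using forms[of X] by (simp add: joint_ideal_def)
    then have "eval3 (prod p X) v = 0" using assms(3) by blast
    then show False using p(2) assms(1) by simp
  qed
  then show thesis using that by blast
qed

text \<open>By the Nullstellensatz, two graded ideals without common zeros together contain all forms of
  large degree.\<close>

lemma codim_ge_Int:
  assumes A: "graded_ideal A" "codim_ge A w" and B: "graded_ideal B" "codim_ge B w'"
    and no: "\<And>v. v \<noteq> 0 \<Longrightarrow> (\<And>n p. p \<in> A n \<Longrightarrow> eval3 p v = 0) \<Longrightarrow> (\<And>n p. p \<in> B n \<Longrightarrow> eval3 p v = 0) \<Longrightarrow> False"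
  shows "codim_ge (\<lambda>n. A n \<inter> B n) (w + w')"
proof -
  have J: "graded_ideal (ideal_sum A B)" by (rule graded_ideal_sum[OF A(1) B(1)])
  have "\<exists>N\<ge>0. ideal_sum A B N = forms N"
  proof (rule ccontr)
    assume "\<not> ?thesis"
    then have "\<And>n. n \<ge> 0 \<Longrightarrow> ideal_sum A B n \<noteq> forms n" by blast
    then obtain v where "v \<noteq> 0" "\<And>n F. F \<in> ideal_sum A B n \<Longrightarrow> eval3 F v = 0"
      using projective_nullstellensatz[OF J] by blast
    then show False using no[of v] ideal_sum_upper[OF A(1) B(1)] by blast
  qed
  then obtain N where N: "N \<ge> 0" "\<And>n. n \<ge> N \<Longrightarrow> ideal_sum A B n = forms n"
    using graded_ideal_full_mono[OF J] by blast
  obtain n1 where n1: "\<And>n. n \<ge> n1 \<Longrightarrow> int (S3.dim (A n)) + w \<le> int (S3.dim (forms n))"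
    using A(2) unfolding codim_ge_def by blast
  obtain n2 where n2: "\<And>n. n \<ge> n2 \<Longrightarrow> int (S3.dim (B n)) + w' \<le> int (S3.dim (forms n))"
    using B(2) unfolding codim_ge_def by blast
  show ?thesis unfolding codim_ge_def
  proof (intro exI allI impI)
    fix n assume n: "n \<ge> max N (max n1 n2)"
    have "S3.dim (forms n) + S3.dim (A n \<inter> B n) = S3.dim (A n) + S3.dim (B n)"
      using dim_ideal_sum[OF A(1) B(1), of n] N(2)[of n] n by simp
    then show "int (S3.dim (A n \<inter> B n)) + (w + w') \<le> int (S3.dim (forms n))"
      using n1[of n] n2[of n] n by linarith
  qed
qed

text \<open>Two members determine \<open>f\<close> and \<open>g\<close>, so a common zero of two of the ideals is a base point, at which a
  member is singular. Hence the codimensions of the ideals add up. Their intersection contains the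
  minors, which can be formed with any member in place of \<open>f\<close> or \<open>g\<close>.\<close>

lemma sum_of_sing_bounds_le:
  assumes f: "f \<in> forms (int e + 1)" and g: "g \<in> forms (int e + 1)" and co: "coprime f g"
    and tr: "transverse_at_base_points f g"
    and X: "finite X" "X \<noteq> {}"
    and F: "\<And>x. x \<in> X \<Longrightarrow> F x = scale (a x) f + scale (b x) g"
    and distinct: "\<And>x y. x \<in> X \<Longrightarrow> y \<in> X \<Longrightarrow> x \<noteq> y \<Longrightarrow> a x * b y \<noteq> a y * b x"
    and nz: "\<And>x. x \<in> X \<Longrightarrow> (a x, b x) \<noteq> (0, 0)"
    and bd: "\<And>x. x \<in> X \<Longrightarrow> sing_bound (F x) (int e + 1) (w x)"
  shows "(\<Sum>x\<in>X. w x) \<le> 3 * (int e * int e)"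
proof -
  obtain K where K: "\<And>x. x \<in> X \<Longrightarrow> graded_ideal (K x)"
    "\<And>x i. x \<in> X \<Longrightarrow> pd i (F x) \<in> K x (int e)" "\<And>x. x \<in> X \<Longrightarrow> codim_ge (K x) (w x)"
    using bd unfolding sing_bound_def by (simp add: add_diff_cancel_right') metis
  have Ff: "F x \<in> forms (int e + 1)" if "x \<in> X" for x
    using F[OF that] forms_add forms_scale f g by simp
  have no_common: False if "x \<in> X" "y \<in> X" "x \<noteq> y" "v \<noteq> 0"
    "\<And>n p. p \<in> K x n \<Longrightarrow> eval3 p v = 0" "\<And>n p. p \<in> K y n \<Longrightarrow> eval3 p v = 0" for x y v
  proof -
    have grad: "eval3 (pd i (F x)) v = 0" "eval3 (pd i (F y)) v = 0" for i
      using that K(2) by blast+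
    have e1: "of_int (int e + 1) \<noteq> (0 :: complex)"
      by (metis of_int_eq_0_iff of_nat_0_le_iff add_nonneg_eq_0_iff zero_le_one zero_neq_one)
    have "eval3 (F x) v = 0" "eval3 (F y) v = 0"
      using eval3_euler[OF Ff[OF that(1)], of v] eval3_euler[OF Ff[OF that(2)], of v] grad e1 by auto
    then have z: "a x * eval3 f v + b x * eval3 g v = 0" "a y * eval3 f v + b y * eval3 g v = 0"
      using F[OF that(1)] F[OF that(2)] by auto
    have "(a x * b y - a y * b x) * eval3 f v = b y * (a x * eval3 f v + b x * eval3 g v) - b x * (a y * eval3 f v + b y * eval3 g v)"
      "(a x * b y - a y * b x) * eval3 g v = a x * (a y * eval3 f v + b y * eval3 g v) - a y * (a x * eval3 f v + b x * eval3 g v)"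
      by (simp_all add: algebra_simps)
    then have "eval3 f v = 0" "eval3 g v = 0" using z distinct[OF that(1-3)] by auto
    then have "is_base_point f g v" using that(4) by (simp add: is_base_point_def)
    moreover have "a x *s gradient f v + b x *s gradient g v = 0"
      using grad(1) by (simp add: vec_eq_iff gradient_nth F[OF that(1)])
    ultimately show False using tr nz[OF that(1)] unfolding transverse_at_base_points_def by blast
  qed
  have joint: "codim_ge (joint_ideal Y K) (sum w Y)" if "Y \<subseteq> X" for Y
  proof -
    have "finite Y" using that X(1) by (rule finite_subset)
    then show ?thesis using that
    proof (induction Y rule: finite_induct)
      case empty
      have "joint_ideal {} K = forms" by (auto simp: joint_ideal_def fun_eq_iff)
      then show ?case by (simp add: codim_ge_def)
    next
      case (insert x Y)
      have "codim_ge (\<lambda>n. K x n \<inter> joint_ideal Y K n) (w x + sum w Y)"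
      proof (rule codim_ge_Int)
        show "graded_ideal (K x)" "codim_ge (K x) (w x)" using K insert.prems by auto
        show "graded_ideal (joint_ideal Y K)" using K(1) insert.prems by (intro graded_ideal_joint) auto
        show "codim_ge (joint_ideal Y K) (sum w Y)" using insert by auto
      next
        fix v assume v: "v \<noteq> 0" "\<And>n p. p \<in> K x n \<Longrightarrow> eval3 p v = 0"
          "\<And>n p. p \<in> joint_ideal Y K n \<Longrightarrow> eval3 p v = 0"
        have KY: "\<And>y. y \<in> Y \<Longrightarrow> graded_ideal (K y)" using K(1) insert.prems by auto
        obtain y where y: "y \<in> Y" "\<And>n p. p \<in> K y n \<Longrightarrow> eval3 p v = 0"
          by (rule joint_ideal_common_zero[where K = K and v = v and X = Y]) (use insert.hyps(1) KY v(3) in blast)+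
        have "x \<noteq> y" "x \<in> X" "y \<in> X" using y(1) insert.hyps insert.prems by auto
        then show False using no_common[of x y v] v(1,2) y(2) by blast
      qed
      then show ?case using insert.hyps by (simp add: joint_ideal_insert[abs_def])
    qed
  qed
  have J: "graded_ideal (joint_ideal X K)" by (rule graded_ideal_joint[OF K(1)])
  have minors: "minor f g i j \<in> joint_ideal X K (2 * int e)" for i j
  proof -
    have "minor f g i j \<in> K x (2 * int e)" if x: "x \<in> X" for x
    proof -
      note sub = graded_idealD(2)[OF K(1)[OF x]]
      have *: "G * pd i (F x) \<in> K x (2 * int e)" if "G \<in> forms (int e)" for G i
        unfolding mult_2 by (rule graded_idealD(4)[OF K(1)[OF x] K(2)[OF x] that])
      have pf: "pd i f \<in> forms (int e)" and pg: "pd i g \<in> forms (int e)" for i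
        using forms_pd[OF f, of i] forms_pd[OF g, of i] by auto
      have 1: "scale (a x) (minor f g i j) = pd j g * pd i (F x) - pd i g * pd j (F x)"
        and 2: "scale (b x) (minor f g i j) = pd i f * pd j (F x) - pd j f * pd i (F x)"
        by (simp_all add: minor_def F[OF x] scale_conv pd_mult algebra_simps)
      have "scale (a x) (minor f g i j) \<in> K x (2 * int e)" "scale (b x) (minor f g i j) \<in> K x (2 * int e)"
        unfolding 1 2 by (intro S3.subspace_diff[OF sub] * pf pg)+
      then have "scale (inverse (a x)) (scale (a x) (minor f g i j)) \<in> K x (2 * int e)"
        "scale (inverse (b x)) (scale (b x) (minor f g i j)) \<in> K x (2 * int e)"
        by (auto intro: S3.subspace_scale[OF sub] simp del: S3.scale_scale)
      then show ?thesis using nz[OF x] by (cases "a x = 0") auto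
    qed
    then show ?thesis using forms_minor[OF f g] by (simp add: joint_ideal_def)
  qed
  obtain n0 where n0: "\<And>n. n \<ge> n0 \<Longrightarrow> int (S3.dim (joint_ideal X K n)) + sum w X \<le> int (S3.dim (forms n))"
    using joint[of X] unfolding codim_ge_def by blast
  define n where "n = max n0 (3 * int e)"
  have "int (S3.dim (forms n)) \<le> int (S3.dim (joint_ideal X K n)) + 3 * (int e * int e)"
    by (rule codim_minors_le[OF f g transverse_minors_gcd[OF f g co tr] J minors]) (simp add: n_def)
  then show ?thesis using n0[of n] by (simp add: n_def)
qed

section \<open>Conic-line curves and concurrent lines\<close>

lemma sing_bound_scale: "sing_bound F D w \<Longrightarrow> sing_bound (scale c F) D w"
  unfolding sing_bound_def using S3.subspace_scale[OF graded_idealD(2)] by auto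

lemma curve_self: "F \<in> curve F"
  unfolding curve_def by (auto intro!: exI[of _ 1])

lemma curve_eqD:
  assumes "curve F = curve G" obtains c where "c \<noteq> 0" "F = scale c G"
  using curve_self[of F] unfolding assms by (auto simp: curve_def)

lemma curve_scale: "c \<noteq> 0 \<Longrightarrow> curve (scale c F) = curve F"
  unfolding curve_def
proof (intro set_eqI iffI)
  fix G assume c: "c \<noteq> 0" and "G \<in> {scale k (scale c F) |k. k \<noteq> 0}"
  then obtain k where "k \<noteq> 0" "G = scale k (scale c F)" by blast
  then show "G \<in> {scale k F |k. k \<noteq> 0}" using c by (intro CollectI exI[of _ "k * c"]) simp
next
  fix G assume c: "c \<noteq> 0" and "G \<in> {scale k F |k. k \<noteq> 0}"
  then obtain k where "k \<noteq> 0" "G = scale k F" by blast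
  then show "G \<in> {scale k (scale c F) |k. k \<noteq> 0}" using c by (intro CollectI exI[of _ "k / c"]) simp
qed

text \<open>The product bound with \<open>D = e + 1\<close> gives \<open>e\<^sup>2 - 1 \<le> 2 * w\<close>, and \<open>w\<close> is an integer.\<close>

lemma conic_line_bound:
  assumes F: "F \<in> forms (int e + 1)" "F \<noteq> 0" and cl: "conic_line_curve (curve F)"
  shows "sing_bound F (int e + 1) ((int e * int e) div 2)"
proof -
  obtain t :: nat and \<alpha> :: "nat \<Rightarrow> poly3" and m :: "nat \<Rightarrow> nat" where
    \<alpha>: "\<And>i. i \<in> {1..t} \<Longrightarrow> is_linear_form (\<alpha> i) \<or> is_irreducible_quadratic_form (\<alpha> i)"
    and eq: "curve F = curve (\<Prod>i=1..t. \<alpha> i ^ m i)"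
    using cl unfolding conic_line_curve_def by blast
  have "\<exists>xs. set xs \<subseteq> \<alpha> ` A \<and> prod_list xs = (\<Prod>i\<in>A. \<alpha> i ^ m i)" if "finite A" for A
    using that
  proof (induction A)
    case empty then show ?case by (intro exI[of _ "[]"]) simp
  next
    case (insert i A)
    then obtain xs where xs: "set xs \<subseteq> \<alpha> ` A" "prod_list xs = (\<Prod>i\<in>A. \<alpha> i ^ m i)" by blast
    then show ?case using insert.hyps
      by (intro exI[of _ "replicate (m i) (\<alpha> i) @ xs"]) (auto simp: prod_list_replicate)
  qed
  then obtain xs where xs: "set xs \<subseteq> \<alpha> ` {1..t}" "prod_list xs = (\<Prod>i=1..t. \<alpha> i ^ m i)"
    by (metis finite_atLeastAtMost)
  have "x \<noteq> 0 \<and> (x \<in> forms 1 \<or> x \<in> forms 2)" if x: "x \<in> set xs" for x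
  proof -
    obtain i where i: "i \<in> {1..t}" "x = \<alpha> i" using x xs(1) by blast
    have "irreducible x \<Longrightarrow> x \<noteq> 0" by (auto simp: irreducible_def)
    then show ?thesis using \<alpha>[OF i(1)] i(2)
      unfolding is_linear_form_def is_irreducible_quadratic_form_def is_form_iff_forms by auto
  qed
  then obtain D K w where DK: "prod_list xs \<in> K D" "D\<^sup>2 - 2 * D \<le> 2 * w" "graded_ideal K"
     "\<And>i. pd i (prod_list xs) \<in> K (D - 1)" "codim_ge K w"
    using product_of_lines_and_conics_bound[of xs] by metis
  obtain c where c: "c \<noteq> 0" "F = scale c (prod_list xs)" using curve_eqD[OF eq] xs(2) by metis
  have "F \<in> forms D" using DK(1) graded_idealD(1)[OF DK(3)] forms_scale unfolding c(2) by blast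
  then have D: "D = int e + 1" using forms_unique F by blast
  have "sing_bound (prod_list xs) D w" unfolding sing_bound_def using DK by blast
  then have "sing_bound F (int e + 1) w" unfolding c(2) D by (rule sing_bound_scale)
  moreover have "(int e * int e) div 2 \<le> w"
  proof -
    have "int e * int e - 1 \<le> 2 * w" using DK(2) unfolding D by (simp add: power2_eq_square algebra_simps)
    then show ?thesis by linarith
  qed
  ultimately show ?thesis by (rule sing_bound_mono)
qed

text \<open>The derivative of each line in the direction of the common point is its value at that point, which
  is zero. By the Leibniz rule the product has derivative zero in this direction as well.\<close>

lemma pencil_of_lines_bound:
  assumes F: "F \<in> forms (int e + 1)" and pl: "pencil_of_lines d (curve F)"
  shows "sing_bound F (int e + 1) (int e * int e)"
proof -
  obtain l :: "nat \<Rightarrow> poly3" and v where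
    lin: "\<forall>i\<in>{1..d}. is_linear_form (l i)" and ev: "\<forall>i\<in>{1..d}. eval3 (l i) v = 0"
    and v: "v \<noteq> 0" and eq: "curve F = curve (\<Prod>i=1..d. l i)"
    using pl unfolding pencil_of_lines_def by (elim exE conjE)
  note l = lin[rule_format] ev[rule_format]
  define dv where "dv G = (\<Sum>j\<in>UNIV. scale (v $ j) (pd j G))" for G
  have dv_mult: "dv (G * H) = dv G * H + G * dv H" for G H
    by (simp add: dv_def sum_3 scale_conv pd_mult algebra_simps)
  have dv_l: "dv (l i) = 0" if "i \<in> {1..d}" for i
  proof -
    have li: "l i \<in> forms 1" using l(1)[OF that] by (simp add: is_linear_form_def is_form_iff_forms)
    have "dv (l i) \<in> forms 0" unfolding dv_def using forms_pd[OF li] by (intro forms_sum forms_scale) simp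
    then obtain k where k: "dv (l i) = const3 k" using forms_zeroD by blast
    have "eval3 (dv (l i)) v = eval3 (l i) v" unfolding dv_def using eval3_euler[OF li, of v] by simp
    then show ?thesis using k l(2)[OF that] by simp
  qed
  have "dv (prod l A) = 0" if "finite A" "A \<subseteq> {1..d}" for A
    using that
  proof (induction A rule: finite_induct)
    case empty show ?case by (simp add: dv_def)
  next
    case (insert i A)
    then show ?case using dv_l[of i] by (simp add: dv_mult)
  qed
  then have "dv (\<Prod>i=1..d. l i) = 0" by simp
  moreover obtain c where c: "F = scale c (\<Prod>i=1..d. l i)" using curve_eqD[OF eq] by blast
  moreover have "dv (scale c G) = scale c (dv G)" for G
    by (simp add: dv_def S3.scale_sum_right mult.commute)
  ultimately have "dv F = 0" by simp
  then show ?thesis using cone_bound[OF F v] by (simp add: dv_def)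
qed

definition weight :: "nat \<Rightarrow> poly3 set \<Rightarrow> int" where
  "weight e C = (if pencil_of_lines (Suc e) C then int e * int e else (int e * int e) div 2)"

lemma weights_le:
  assumes f: "is_form (Suc e) f" and g: "is_form (Suc e) g" and co: "coprime f g"
    and tr: "transverse_at_base_points f g"
    and X: "finite X" "X \<subseteq> {C \<in> pencil f g. conic_line_curve C}"
  shows "(\<Sum>C\<in>X. weight e C) \<le> 3 * (int e * int e)"
proof (cases "X = {}")
  case False
  have f': "f \<in> forms (int e + 1)" and g': "g \<in> forms (int e + 1)"
    using f g by (simp_all add: is_form_iff_forms add.commute)
  have "\<exists>a b. C = curve (scale a f + scale b g) \<and> (a, b) \<noteq> (0, 0)" if "C \<in> X" for C
    using that X(2) unfolding pencil_def by blast
  then obtain a b where ab: "\<And>C. C \<in> X \<Longrightarrow> C = curve (scale (a C) f + scale (b C) g)"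
    "\<And>C. C \<in> X \<Longrightarrow> (a C, b C) \<noteq> (0, 0)" by metis
  define F where "F C = scale (a C) f + scale (b C) g" for C
  have Ff: "F C \<in> forms (int e + 1)" for C unfolding F_def using f' g' by (intro forms_add forms_scale)
  have F0: "F C \<noteq> 0" if "C \<in> X" for C
    using coprime_forms_combination_nonzero[of f "Suc e" g, OF _ _ _ co ab(2)[OF that]] f g
    by (simp add: F_def is_form_iff_forms)
  show ?thesis
  proof (rule sum_of_sing_bounds_le[OF f' g' co tr X(1) False, of F a b])
    fix x y assume xy: "x \<in> X" "y \<in> X" "x \<noteq> y"
    show "a x * b y \<noteq> a y * b x"
    proof
      assume det: "a x * b y = a y * b x"
      have "\<exists>c. c \<noteq> 0 \<and> a x = c * a y \<and> b x = c * b y"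
      proof (cases "a y = 0")
        case True
        then have "b y \<noteq> 0" "a x = 0" "b x \<noteq> 0" using ab(2) xy det by fastforce+
        then show ?thesis using True by (intro exI[of _ "b x / b y"]) simp
      next
        case False
        then have "a x \<noteq> 0" using ab(2)[OF xy(1)] det by auto
        then show ?thesis using False det by (intro exI[of _ "a x / a y"]) (simp add: field_simps)
      qed
      then obtain c where c: "c \<noteq> 0" "a x = c * a y" "b x = c * b y" by blast
      then have "F x = scale c (F y)" by (simp add: F_def S3.scale_right_distrib)
      then show False using curve_scale[OF c(1), of "F y"] ab(1) xy unfolding F_def by metis
    qed
  next
    fix x assume x: "x \<in> X"
    have C: "x = curve (F x)" "conic_line_curve x" using ab(1)[OF x] x X(2) by (auto simp: F_def)
    show "sing_bound (F x) (int e + 1) (weight e x)"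
      using conic_line_bound[OF Ff F0[OF x]] pencil_of_lines_bound[OF Ff, of "Suc e" x] C
      unfolding weight_def by metis
  qed (use ab in \<open>auto simp: F_def\<close>)
qed simp

theorem mainTheorem1:
  fixes d m p :: nat and f g :: poly3
  assumes "d > 2"
    and "is_form d f" and "is_form d g"
    and "coprime f g"
    and "transverse_at_base_points f g"
    and "m = card {C \<in> pencil f g. conic_line_curve C}"
    and "p = card {C \<in> pencil f g. conic_line_curve C \<and> pencil_of_lines d C}"
  shows "finite {C \<in> pencil f g. conic_line_curve C} \<and>
         m \<le> 6 \<and>
         (p = 1 \<longrightarrow> m \<le> 5) \<and>
         (p = 2 \<longrightarrow> m \<le> 4) \<and>
         (p = 3 \<longrightarrow> m = 3)"
proof -
  obtain e where e: "d = Suc e" "e \<ge> 2" using assms(1) by (cases d) auto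
  let ?M = "{C \<in> pencil f g. conic_line_curve C}"
  let ?P = "{C \<in> pencil f g. conic_line_curve C \<and> pencil_of_lines d C}"
  define q where "q = int e * int e"
  \<comment> \<open>For \<open>d = 3\<close> the estimate \<open>q div 2\<close> exceeds \<open>d * (d - 2) / 2\<close>, and \<open>7 * (q div 2) \<le> 3 * q\<close> fails
    for \<open>q = 4\<close> only because of this rounding.\<close>
  have q: "q = 4 \<or> q \<ge> 9"
  proof (cases "e = 2")
    case False
    then have "int e \<ge> 3" using e(2) by simp
    then have "3 * 3 \<le> q" unfolding q_def by (intro mult_mono) auto
    then show ?thesis by simp
  qed (simp add: q_def)
  have sum_le: "(\<Sum>C\<in>X. weight e C) \<le> 3 * q" if "finite X" "X \<subseteq> ?M" for X
    using weights_le[of e f g X] assms(2-5) that unfolding e(1) q_def by blast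
  have weight: "weight e C = (if pencil_of_lines d C then q else q div 2)" for C
    by (simp add: weight_def q_def e(1))
  have card_le: "card X \<le> 6" if "finite X" "X \<subseteq> ?M" for X
  proof -
    have "(\<Sum>C\<in>X. q div 2) \<le> (\<Sum>C\<in>X. weight e C)"
      using q by (intro sum_mono) (auto simp: weight)
    then have "int (card X) * (q div 2) \<le> 3 * q" using sum_le[OF that] by simp
    moreover have "7 * (q div 2) \<le> int (card X) * (q div 2)" if "card X \<ge> 7"
      using that q by (intro mult_right_mono) auto
    ultimately show ?thesis using q by (cases "card X \<ge> 7") auto
  qed
  have fin: "finite ?M"
  proof (rule ccontr)
    assume "infinite ?M"
    then obtain X where "finite X" "card X = 7" "X \<subseteq> ?M" using infinite_arbitrarily_large by blast
    then show False using card_le[of X] by simp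
  qed
  have PM: "?P \<subseteq> ?M" by blast
  have finP: "finite ?P" using PM fin by (rule finite_subset)
  have pm: "p \<le> m" unfolding assms(6,7) by (rule card_mono[OF fin PM])
  have "card (?M - ?P) = m - p" unfolding assms(6,7) by (rule card_Diff_subset[OF finP PM])
  then have cd: "int (card (?M - ?P)) = int m - int p" using pm by simp
  have "(\<Sum>C\<in>?M. weight e C) = (\<Sum>C\<in>?M - ?P. weight e C) + (\<Sum>C\<in>?P. weight e C)"
    by (rule sum.subset_diff[OF PM fin])
  also have "(\<Sum>C\<in>?M - ?P. weight e C) = (\<Sum>C\<in>?M - ?P. q div 2)"
    by (rule sum.cong) (auto simp: weight)
  also have "\<dots> = (int m - int p) * (q div 2)" using cd by simp
  also have "(\<Sum>C\<in>?P. weight e C) = (\<Sum>C\<in>?P. q)"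
    by (rule sum.cong) (auto simp: weight)
  also have "\<dots> = int p * q" by (simp add: assms(7))
  finally have main: "(int m - int p) * (q div 2) + int p * q \<le> 3 * q"
    using sum_le[OF fin] by simp
  have lower: "k * (q div 2) \<le> (int m - int p) * (q div 2)" if "k \<le> int m - int p" for k
    using that q by (intro mult_right_mono) auto
  have "m \<le> 6" using card_le[OF fin] assms(6) by simp
  moreover have "m \<le> 5" if "p = 1"
    using main lower[of 5] q that by (cases "m \<ge> 6") auto
  moreover have "m \<le> 4" if "p = 2"
    using main lower[of 3] q that by (cases "m \<ge> 5") auto
  moreover have "m = 3" if "p = 3"
    using main lower[of 1] q that pm by (cases "m \<ge> 4") auto
  ultimately show ?thesis using fin by blast
qed

end
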